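(* Let $G$ be a simple connected graph (directed or undirected) on $N\ge 2$ vertices with adjacency matrix $\mathbf{A}$ and in-degree matrix $D^{in}$. Let $f:\mathbb{R}^d\to\mathbb{R}^d$ be $C^1$ with $f(0)=0$, let $\nu_1,\dots,\nu_d$ be the eigenvalues of the Jacobian $\frac{\partial f}{\partial x}(0)$, and assume $\nu_{\max}:=\max_i \operatorname{Re}(\nu_i)\neq 0$. Let $L$ be either $L^{-}=D^{in}-\mathbf{A}$ or $L^{+}=D^{in}+\mathbf{A}$, and for $\alpha\in\mathbb{R}$ consider the network system on $\mathbb{R}^{Nd}$ $$\dot{\mathbf{x}}=\mathbf{f}(\mathbf{x})+\alpha\,(L\otimes I_d)\,\mathbf{x},\qquad \mathbf{f}(\mathbf{x})=[f(x_1),\dots,f(x_N)]^T .$$ Assume $0$ is not an eigenvalue of $L$ and that the origin is an unstable equilibrium of the node dynamics $\dot x=f(x)$. Then there exists a critical coupling parameter value $\alpha_c<0$ such that the origin of the network system is (locally) exponentially stable for every $\alpha<\alpha_c$ and unstable for every $\alpha>\alpha_c$.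
   Context: The adjacency matrix $\mathbf{A}$ has entries in $\{0,1\}$ and zero diagonal (simple graph: no self-loops, no multiple edges); $D^{in}=\mathrm{diag}(\mathbf{A}\mathbf{1})$, where $\mathbf{1}$ is the all-ones vector, so the in-degree of node $i$ is $\sum_j \mathbf{A}_{ij}$. A directed graph is called connected if its underlying undirected graph is connected. $\mathbf{x}=[x_1,\dots,x_N]^T$ with $x_i\in\mathbb{R}^d$. The choice $L=L^-$ corresponds to diffusive coupling ($\beta=-\alpha$) and $L=L^+$ to signless-diffusive coupling ($\beta=\alpha$) in the general linear coupling $\alpha D^{in}+\beta\mathbf{A}$. All stability notions are local and refer to the equilibrium at the origin (stable = Lyapunov stable, unstable = not Lyapunov stable). *)

theory Defs
  imports "HOL-Analysis.Analysis" "Graph_Theory.Digraph_Component"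
begin

section \<open>Graphs and matrices\<close>

text \<open>Row \<open>i\<close> collects the arcs entering vertex \<open>i\<close>, so that row sums are in-degrees.\<close>

definition adjacency_matrix :: "('n::finite, 'e) pre_digraph \<Rightarrow> real^'n^'n" where
  "adjacency_matrix G = (\<chi> i j. if (j, i) \<in> arcs_ends G then 1 else 0)"

definition diag_matrix :: "real^'n \<Rightarrow> real^'n^'n" where
  "diag_matrix v = (\<chi> i j. if i = j then v $ i else 0)"

definition in_degree_matrix :: "('n::finite, 'e) pre_digraph \<Rightarrow> real^'n^'n" where
  "in_degree_matrix G = diag_matrix (adjacency_matrix G *v 1)"

definition laplacian :: "('n::finite, 'e) pre_digraph \<Rightarrow> real^'n^'n" where
  "laplacian G = in_degree_matrix G - adjacency_matrix G"

definition signless_laplacian :: "('n::finite, 'e) pre_digraph \<Rightarrow> real^'n^'n" where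
  "signless_laplacian G = in_degree_matrix G + adjacency_matrix G"

definition eigenvalues :: "real^'n^'n \<Rightarrow> complex set" where
  "eigenvalues M = {\<mu>. \<exists>v. v \<noteq> 0 \<and> map_matrix complex_of_real M *v v = \<mu> *s v}"

definition kronecker :: "real^'n^'n \<Rightarrow> real^'d^'d \<Rightarrow> real^('n::finite \<times> 'd::finite)^('n::finite \<times> 'd::finite)" where
  "kronecker M B = (\<chi> p q. M $ fst p $ fst q * B $ snd p $ snd q)"

section \<open>Continuously differentiable maps and network systems\<close>

definition C1 :: "(real^'d \<Rightarrow> real^'d) \<Rightarrow> bool" where
  "C1 f \<longleftrightarrow> (\<forall>x. f differentiable (at x)) \<and> continuous_on UNIV (\<lambda>x. jacobian f (at x))"

text \<open>A state in \<open>\<real>\<^sup>N\<^sup>d\<close> is indexed by pairs of a node and a coordinate.\<close>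

definition node_state :: "real^('n::finite \<times> 'd::finite) \<Rightarrow> 'n \<Rightarrow> real^'d" where
  "node_state x i = (\<chi> k. x $ (i, k))"

definition stack_field :: "(real^'d \<Rightarrow> real^'d) \<Rightarrow> real^('n::finite \<times> 'd::finite) \<Rightarrow> real^('n::finite \<times> 'd::finite)" where
  "stack_field f x = (\<chi> p. f (node_state x (fst p)) $ snd p)"

definition network_field ::
    "(real^'d \<Rightarrow> real^'d) \<Rightarrow> real^'n^'n \<Rightarrow> real \<Rightarrow> real^('n::finite \<times> 'd::finite) \<Rightarrow> real^('n::finite \<times> 'd::finite)" where
  "network_field f L \<alpha> x = stack_field f x + \<alpha> *\<^sub>R (kronecker L (mat 1) *v x)"

section \<open>Stability for autonomous systems\<close>

definition solves_on ::
    "('a::real_normed_vector \<Rightarrow> 'a) \<Rightarrow> (real \<Rightarrow> 'a) \<Rightarrow> real set \<Rightarrow> bool" where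
  "solves_on g x J \<longleftrightarrow> (\<forall>t\<in>J. (x has_vector_derivative g (x t)) (at t within J))"

text \<open>Both notions require that a solution starting close to \<open>p\<close> exists for all
  nonnegative times, and that the estimate holds for every solution with that initial
  value, including those given only on a bounded interval \<open>[0, T)\<close>.\<close>

definition lyapunov_stable :: "('a::real_normed_vector \<Rightarrow> 'a) \<Rightarrow> 'a \<Rightarrow> bool" where
  "lyapunov_stable g p \<longleftrightarrow>
    (\<forall>\<epsilon>>0. \<exists>\<delta>>0. \<forall>x0. norm (x0 - p) < \<delta> \<longrightarrow>
      (\<exists>x. solves_on g x {0..} \<and> x 0 = x0) \<and>
      (\<forall>x T. solves_on g x {0..<T} \<and> x 0 = x0 \<longrightarrow>
        (\<forall>t\<in>{0..<T}. norm (x t - p) < \<epsilon>)))"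

definition exponentially_stable :: "('a::real_normed_vector \<Rightarrow> 'a) \<Rightarrow> 'a \<Rightarrow> bool" where
  "exponentially_stable g p \<longleftrightarrow>
    (\<exists>\<delta>>0. \<exists>C>0. \<exists>r>0. \<forall>x0. norm (x0 - p) < \<delta> \<longrightarrow>
      (\<exists>x. solves_on g x {0..} \<and> x 0 = x0) \<and>
      (\<forall>x T. solves_on g x {0..<T} \<and> x 0 = x0 \<longrightarrow>
        (\<forall>t\<in>{0..<T}. norm (x t - p) \<le> C * exp (- r * t) * norm (x0 - p))))"

end

theory Submission
  imports Defs "HOL-Computational_Algebra.Fundamental_Theorem_Algebra"
begin

text \<open>
  The linearization of the network at the origin is \<open>I \<otimes> J + \<alpha> L \<otimes> I\<close>, where
  \<open>J\<close> is the Jacobian of \<open>f\<close> at \<open>0\<close>. Its summands commute, so its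
  eigenvalues are the sums \<open>\<nu> + \<alpha> z\<close> of eigenvalues \<open>\<nu>\<close> of \<open>J\<close> and
  \<open>z\<close> of \<open>L\<close> (\<open>eigenvalues_network_jacobian\<close>). Gershgorin's theorem puts
  the spectrum of both Laplacians into the right half plane with \<open>0\<close> as the only possible
  point on the imaginary axis; as \<open>0\<close> is excluded, the smallest real part \<open>z\<^sub>m\<close> of an
  eigenvalue of \<open>L\<close> is positive. The largest real part \<open>\<nu>\<^sub>m\<close> of an eigenvalue of
  \<open>J\<close> is positive as well, since otherwise the node dynamics would be stable. For
  \<open>\<alpha> \<le> 0\<close> the largest real part in the spectrum of the network is therefore
  \<open>\<nu>\<^sub>m + \<alpha> z\<^sub>m\<close>, for \<open>\<alpha> \<ge> 0\<close> it is at least that number, and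
  \<open>\<alpha>\<^sub>c = - \<nu>\<^sub>m / z\<^sub>m\<close> is the zero of this affine function.

  The passage from eigenvalues to stability is Lyapunov's indirect method, in both directions
  (\<open>exponentially_stable_if_eigenvalues_negative\<close>, \<open>unstable_if_eigenvalue_positive\<close>).
  Both rest on one quadratic form (\<open>spectral_gap_energy_form\<close>): if no eigenvalue of
  \<open>A\<close> has real part \<open>c\<close>, there is a form \<open>Q\<close> whose derivative along
  \<open>x' = A x\<close> exceeds \<open>2 c Q\<close> by a positive definite form. It is negative definite if
  the spectrum lies to the left of \<open>c\<close>, and it takes positive values if some eigenvalue lies
  to the right. With \<open>c < 0\<close> its negative is a Lyapunov function, with \<open>c > 0\<close> it is a
  Chetaev function, and the positive definite excess absorbs the nonlinear terms. The form is
  obtained without a Jordan or Schur decomposition, from a list of eigenvalues whose shifted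
  product \<open>\<Prod>(A - z)\<close> vanishes (\<open>chain_energy_form\<close>).
\<close>

section \<open>Annihilating products of shifted matrices\<close>

text \<open>The value of a polynomial at a matrix, applied to a vector and computed by Horner's rule.
  Matrices of type \<open>complex^'m^'m\<close> carry the entrywise product, so the polynomial is
  evaluated through its action on vectors.\<close>

definition apply_poly :: "complex^'m^'m \<Rightarrow> complex poly \<Rightarrow> complex^'m \<Rightarrow> complex^'m" where
  "apply_poly M p v = fold_coeffs (\<lambda>a w. a *s v + M *v w) p 0"

lemma apply_poly_0 [simp]: "apply_poly M 0 v = 0"
  by (simp add: apply_poly_def)

lemma apply_poly_pCons [simp]: "apply_poly M (pCons a p) v = a *s v + M *v apply_poly M p v"
  by (cases "a = 0 \<and> p = 0") (auto simp: apply_poly_def)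

lemma apply_poly_add: "apply_poly M (p + q) v = apply_poly M p v + apply_poly M q v"
  by (induction p q rule: poly_induct2)
    (simp_all add: vector_sadd_rdistrib matrix_vector_right_distrib)

lemma apply_poly_smult: "apply_poly M (smult c p) v = c *s apply_poly M p v"
  by (induction p) (simp_all add: vector_scalar_commute vector_add_ldistrib)

lemma apply_poly_minus_vector: "apply_poly M p (v - w) = apply_poly M p v - apply_poly M p w"
  by (induction p) (simp_all add: matrix_vector_mult_diff_distrib vector_ssub_ldistrib add_diff_add)

lemma apply_poly_scale_vector: "apply_poly M p (c *s v) = c *s apply_poly M p v"
  by (induction p) (simp_all add: vector_scalar_commute vector_add_ldistrib mult.commute)

lemma apply_poly_mult_matrix: "apply_poly M p (M *v v) = M *v apply_poly M p v"
  by (induction p) (simp_all add: vector_scalar_commute matrix_vector_right_distrib)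

text \<open>The factor is moved into the argument, so that a factorization of the polynomial unfolds along
  the vectors \<open>v\<close>, \<open>(M - z) v\<close>, and so on; these are the chains on which the energy
  forms live.\<close>

lemma apply_poly_linear_factor:
  "apply_poly M ([:-z, 1:] * p) v = apply_poly M p (M *v v - z *s v)"
proof -
  have "[:-z, 1:] * p = smult (-z) p + pCons 0 p"
    by (simp add: mult_pCons_left)
  then show ?thesis
    unfolding apply_poly_minus_vector apply_poly_scale_vector apply_poly_mult_matrix
    by (simp only: apply_poly_add apply_poly_smult apply_poly_pCons) simp
qed

lemma apply_poly_monom: "apply_poly M (monom c k) v = c *s (((*v) M ^^ k) v)"
  by (induction k) (simp_all add: monom_0 monom_Suc vector_scalar_commute)

lemma apply_poly_sum:
  "finite S \<Longrightarrow> apply_poly M (\<Sum>k\<in>S. g k) v = (\<Sum>k\<in>S. apply_poly M (g k) v)"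
  by (induction S rule: finite_induct) (simp_all add: apply_poly_add)

text \<open>The index is tracked instead of the value, because the powers of a matrix may repeat; a
  repetition is itself a dependence.\<close>

lemma sequence_linear_dependence:
  fixes X :: "nat \<Rightarrow> 'a::euclidean_space"
  shows "\<exists>a::nat \<Rightarrow> real. (\<exists>k\<le>DIM('a). a k \<noteq> 0) \<and> (\<Sum>k\<le>DIM('a). a k *\<^sub>R X k) = 0"
proof (cases "inj_on X {..DIM('a)}")
  case True
  then have "card (X ` {..DIM('a)}) > DIM('a)"
    by (simp add: card_image)
  then have "dependent (X ` {..DIM('a)})"
    by (intro dependent_biggerset) auto
  then obtain u where u: "\<exists>v\<in>X ` {..DIM('a)}. u v \<noteq> (0::real)"
      "(\<Sum>v\<in>X ` {..DIM('a)}. u v *\<^sub>R v) = 0"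
    by (subst (asm) dependent_finite) auto
  then show ?thesis
    using True by (intro exI[of _ "u \<circ> X"]) (auto simp: sum.reindex)
next
  case False
  then obtain i j where ij: "i \<le> DIM('a)" "j \<le> DIM('a)" "i \<noteq> j" "X i = X j"
    by (auto simp: inj_on_def)
  let ?a = "\<lambda>k. (if k = i then 1 else 0) - (if k = j then 1 else (0::real))"
  have "(\<Sum>k\<le>DIM('a). ?a k *\<^sub>R X k) =
      (\<Sum>k\<le>DIM('a). if k = i then X k else 0) - (\<Sum>k\<le>DIM('a). if k = j then X k else 0)"
    by (simp add: scaleR_diff_left sum_subtractf if_distrib[of "\<lambda>c. c *\<^sub>R _"] cong: if_cong)
  also have "\<dots> = 0"
    using ij by simp
  finally show ?thesis
    using ij by (intro exI[of _ ?a]) auto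
qed

lemma of_real_vector_scale: "complex_of_real r *s v = r *\<^sub>R v"
  by (simp add: vec_eq_iff scaleR_conv_of_real[where 'a=complex])

lemma scaleR_matrix_vector_mult:
  fixes X :: "'a::real_algebra_1^'n^'m"
  shows "(r *\<^sub>R X) *v v = r *\<^sub>R (X *v v)"
  by (simp add: vec_eq_iff matrix_vector_mult_def scaleR_sum_right)

text \<open>Real coefficients already suffice, since the powers of \<open>M\<close> lie in a real vector space of
  finite dimension.\<close>

lemma annihilating_polynomial:
  fixes M :: "complex^'m^'m"
  obtains p where "p \<noteq> 0" "\<And>v. apply_poly M p v = 0"
proof -
  define X where "X k = ((**) M ^^ k) (mat 1)" for k
  have X: "X k *v v = ((*v) M ^^ k) v" for k v
    by (induction k) (simp_all add: X_def flip: matrix_vector_mul_assoc)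
  define n where "n = DIM(complex^'m^'m)"
  obtain a :: "nat \<Rightarrow> real" where a: "\<exists>k\<le>n. a k \<noteq> 0" "(\<Sum>k\<le>n. a k *\<^sub>R X k) = 0"
    using sequence_linear_dependence[of X] unfolding n_def by blast
  define p where "p = (\<Sum>k\<le>n. monom (complex_of_real (a k)) k)"
  have "coeff p k = a k" if "k \<le> n" for k
    using that by (simp add: p_def coeff_sum)
  then have "p \<noteq> 0"
    using a(1) by (metis coeff_0 of_real_eq_0_iff)
  moreover have "apply_poly M p v = 0" for v
  proof -
    have "apply_poly M p v = (\<Sum>k\<le>n. a k *\<^sub>R (X k *v v))"
      by (simp add: p_def apply_poly_sum apply_poly_monom X of_real_vector_scale)
    also have "\<dots> = (\<Sum>k\<le>n. a k *\<^sub>R X k) *v v"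
      by (induction n) (simp_all add: matrix_vector_mult_add_rdistrib scaleR_matrix_vector_mult)
    finally show ?thesis
      using a(2) by simp
  qed
  ultimately show ?thesis
    using that by blast
qed

text \<open>The product of the commuting matrices \<open>M - z\<close> over the list, with the head acting first:
  the recursion peels off the shifts in the order in which a chain passes through them.\<close>

fun shifted_product :: "complex^'m^'m \<Rightarrow> complex list \<Rightarrow> complex^'m \<Rightarrow> complex^'m" where
  "shifted_product M [] v = v"
| "shifted_product M (z # zs) v = shifted_product M zs (M *v v - z *s v)"

lemma apply_poly_factorization:
  assumes "p \<noteq> 0"
  shows "\<exists>c zs. c \<noteq> 0 \<and> (\<forall>v. apply_poly M p v = c *s shifted_product M zs v)"
  using assms
proof (induction "degree p" arbitrary: p)
  case 0
  then obtain c where "p = [:c:]"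
    using degree_eq_zeroE by metis
  with 0 show ?case
    by (intro exI[of _ c] exI[of _ "[]"]) auto
next
  case (Suc n)
  then obtain z where "poly p z = 0"
    using alg_closed_imp_poly_has_root[of p] by auto
  then have "[:-z, 1:] dvd p"
    by (simp add: poly_eq_0_iff_dvd)
  then obtain q where q: "p = [:-z, 1:] * q" ..
  have "q \<noteq> 0"
    using Suc.prems q by auto
  moreover have "degree p = Suc (degree q)"
    unfolding q using \<open>q \<noteq> 0\<close> by (subst degree_mult_eq) auto
  ultimately obtain c zs where "c \<noteq> 0" "\<forall>v. apply_poly M q v = c *s shifted_product M zs v"
    using Suc.hyps(1)[of q] Suc.hyps(2) by auto
  then show ?case
    unfolding q by (intro exI[of _ c] exI[of _ "z # zs"]) (simp only: apply_poly_linear_factor, simp)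
qed

lemma shifted_product_append:
  "shifted_product M (xs @ ys) v = shifted_product M ys (shifted_product M xs v)"
  by (induction xs arbitrary: v) auto

text \<open>For \<open>C = M\<close> this says that the order of the shifts does not matter.\<close>

lemma shifted_product_intertwine:
  assumes "\<And>v. C *v (M *v v) = M *v (C *v v)"
  shows "shifted_product M zs (C *v v - z *s v)
    = C *v shifted_product M zs v - z *s shifted_product M zs v"
proof (induction zs arbitrary: v)
  case (Cons y ys)
  have "M *v (C *v v - z *s v) - y *s (C *v v - z *s v)
      = C *v (M *v v - y *s v) - z *s (M *v v - y *s v)"
    using assms[of v]
    by (simp add: matrix_vector_mult_diff_distrib vector_scalar_commute vector_ssub_ldistrib
        algebra_simps vector_smult_assoc)
  then show ?case
    using Cons.IH[of "M *v v - y *s v"] by simp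
qed auto

lemma shifted_product_eigenvector:
  assumes "M *v v = \<mu> *s v"
  shows "shifted_product M zs v = (\<Prod>z\<leftarrow>zs. \<mu> - z) *s v"
proof -
  have "shifted_product M zs (a *s v) = ((\<Prod>z\<leftarrow>zs. \<mu> - z) * a) *s v" for a
  proof (induction zs arbitrary: a)
    case (Cons z zs)
    have "M *v (a *s v) - z *s (a *s v) = ((\<mu> - z) * a) *s v"
      by (simp add: vector_scalar_commute assms vector_smult_assoc algebra_simps vector_sub_rdistrib)
    then show ?case
      using Cons.IH[of "(\<mu> - z) * a"] by (simp add: mult_ac)
  qed auto
  from this[of 1] show ?thesis
    by simp
qed

text \<open>A shortest annihilating list contains only eigenvalues: if deleting one entry \<open>z\<close> leaves
  a product that does not vanish, every nonzero value of that product is an eigenvector for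
  \<open>z\<close>. Conversely the product acts on an eigenvector of \<open>\<mu>\<close> as the scalar
  \<open>\<Prod>(\<mu> - z)\<close>, so \<open>\<mu>\<close> has to occur in the list.\<close>

lemma spectral_annihilating_list:
  fixes M :: "complex^'m^'m"
  obtains zs where "set zs = {\<mu>. \<exists>v. v \<noteq> 0 \<and> M *v v = \<mu> *s v}"
    "\<And>v. shifted_product M zs v = 0"
proof -
  have ex: "\<exists>zs. \<forall>v. shifted_product M zs v = 0"
  proof -
    obtain p where p: "p \<noteq> 0" "\<And>v. apply_poly M p v = 0"
      using annihilating_polynomial[of M] by blast
    then obtain c zs where "c \<noteq> 0" "\<forall>v. apply_poly M p v = c *s shifted_product M zs v"
      using apply_poly_factorization by blast
    then show ?thesis
      using p(2) by (intro exI[of _ zs]) auto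
  qed
  obtain zs where zs: "\<And>v. shifted_product M zs v = 0"
    and least: "\<And>ys. \<forall>v. shifted_product M ys v = 0 \<Longrightarrow> length zs \<le> length ys"
    using ex_has_least_nat[of "\<lambda>zs. \<forall>v. shifted_product M zs v = 0" _ length] ex by metis
  have "\<exists>v. v \<noteq> 0 \<and> M *v v = z *s v" if "z \<in> set zs" for z
  proof -
    obtain us vs where split: "zs = us @ z # vs"
      using split_list[OF \<open>z \<in> set zs\<close>] by blast
    then obtain v where v: "shifted_product M (us @ vs) v \<noteq> 0"
      using least[of "us @ vs"] by auto
    have "M *v shifted_product M (us @ vs) v - z *s shifted_product M (us @ vs) v = 0"
      using zs[of v] shifted_product_intertwine[of M M vs "shifted_product M us v" z]
      by (simp add: split shifted_product_append)
    then show ?thesis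
      using v by auto
  qed
  moreover have "\<mu> \<in> set zs" if "v \<noteq> 0" "M *v v = \<mu> *s v" for \<mu> v
  proof -
    have "(\<Prod>z\<leftarrow>zs. \<mu> - z) = 0"
      using zs[of v] that shifted_product_eigenvector[OF that(2), of zs] by auto
    then show ?thesis
      by (auto simp: prod_list_zero_iff)
  qed
  ultimately show ?thesis
    using that zs by blast
qed

lemma finite_eigenvalues: "finite (eigenvalues A)"
proof -
  obtain zs where "set zs = eigenvalues A"
    unfolding eigenvalues_def by (rule spectral_annihilating_list)
  then show ?thesis
    by (metis List.finite_set)
qed

lemma eigenvalues_nonempty: "eigenvalues A \<noteq> {}"
proof -
  obtain zs where zs: "set zs = eigenvalues A"
    "\<And>v. shifted_product (map_matrix complex_of_real A) zs v = 0"
    unfolding eigenvalues_def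
    using spectral_annihilating_list[of "map_matrix complex_of_real A"] by blast
  have "zs \<noteq> []"
    using zs(2)[of "1"] by (auto simp: vec_eq_iff)
  then show ?thesis
    using zs(1) by auto
qed

text \<open>Follow \<open>w\<close> through the shifts of an annihilating list of \<open>C\<close>. The last nonzero
  vector on the way is an eigenvector of \<open>C\<close>, and it is still an eigenvector of
  \<open>M\<close> for \<open>\<mu>\<close> because \<open>M\<close> commutes with the shifts.\<close>

lemma commuting_matrices_common_eigenvector:
  fixes M C :: "complex^'m^'m"
  assumes commute: "\<And>v. C *v (M *v v) = M *v (C *v v)"
    and "w \<noteq> 0" "M *v w = \<mu> *s w"
  obtains v z where "v \<noteq> 0" "M *v v = \<mu> *s v" "C *v v = z *s v"
proof -
  obtain zs where zs: "\<And>v. shifted_product C zs v = 0"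
    using spectral_annihilating_list[of C] by metis
  have "\<exists>v z. v \<noteq> 0 \<and> M *v v = \<mu> *s v \<and> C *v v = z *s v"
    using zs[of w] assms(2,3)
  proof (induction zs arbitrary: w)
    case (Cons z zs)
    show ?case
    proof (cases "C *v w - z *s w = 0")
      case False
      have "M *v (C *v w - z *s w) = \<mu> *s (C *v w - z *s w)"
        using commute[of w] Cons.prems
        by (simp add: matrix_vector_mult_diff_distrib vector_scalar_commute vector_ssub_ldistrib
            vector_smult_assoc mult.commute)
      then show ?thesis
        using Cons.IH[of "C *v w - z *s w"] Cons.prems False by simp
    qed (use Cons.prems in auto)
  qed auto
  then show ?thesis
    using that by blast
qed

section \<open>Quadratic energy forms with a spectral gap\<close>

lemma inner_complex_vector_scale:
  fixes x :: "complex^'m"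
  shows "x \<bullet> (z *s x) = Re z * (norm x)\<^sup>2"
proof -
  have "x $ i \<bullet> (z * x $ i) = Re z * (x $ i \<bullet> x $ i)" for i
    by (simp add: inner_complex_def algebra_simps)
  then show ?thesis
    by (simp add: power2_norm_eq_inner inner_vec_def sum_distrib_left)
qed

lemma inner_imaginary_unit_scale:
  fixes x y :: "complex^'m"
  shows "(\<i> *s x) \<bullet> (\<i> *s y) = x \<bullet> y"
  by (simp add: inner_vec_def inner_complex_def add.commute)

text \<open>Put \<open>y\<^sub>0 = x\<close> and \<open>y\<^sub>k\<^sub>+\<^sub>1 = (M - z\<^sub>k) y\<^sub>k\<close>. Along \<open>x' = M x\<close> the chain
  satisfies \<open>y\<^sub>k' = z\<^sub>k y\<^sub>k + y\<^sub>k\<^sub>+\<^sub>1\<close>, and it ends in \<open>0\<close> when the list annihilates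
  \<open>x\<close>: the linear system has been brought into triangular form without choosing a basis.
  The form is a weighted sum of the \<open>\<plusminus>|y\<^sub>k|\<^sup>2\<close>, with the minus sign for the \<open>z\<^sub>k\<close> to the
  left of the line \<open>Re = c\<close>. The weights form a geometric progression whose ratio is
  large enough for the squares to absorb the couplings \<open>y\<^sub>k \<bullet> y\<^sub>k\<^sub>+\<^sub>1\<close>. Twice \<open>B x (M x - c x)\<close> is the derivative of
  \<open>B x x\<close> along the flow minus \<open>2 c B x x\<close>. The invariance under multiplication by
  \<open>\<i>\<close> makes \<open>x\<close> and \<open>\<i> x\<close> orthogonal for the form, which is how its value
  on complex eigenvectors is found.\<close>

lemma chain_energy_form:
  fixes M :: "complex^'m^'m"
  assumes "\<eta> > 0" and "\<forall>z\<in>set zs. 2 * \<eta> \<le> \<bar>Re z - c\<bar>"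
  shows "\<exists>B. bilinear B \<and> (\<forall>x y. B x y = B y x) \<and> (\<forall>x y. B (\<i> *s x) (\<i> *s y) = B x y) \<and>
    (\<forall>x. shifted_product M zs x = 0 \<longrightarrow> \<eta> * (norm x)\<^sup>2 \<le> B x (M *v x - c *\<^sub>R x)) \<and>
    ((\<forall>z\<in>set zs. Re z < c) \<longrightarrow> (\<forall>x. shifted_product M zs x = 0 \<longrightarrow> B x x \<le> - (norm x)\<^sup>2))"
  using assms(2)
proof (induction zs)
  case Nil
  then show ?case
    by (intro exI[of _ "\<lambda>x y. 0"]) (auto simp: bilinear_def linear_iff)
next
  case (Cons z zs)
  then obtain B where B: "bilinear B" "\<And>x y. B x y = B y x" "\<And>x y. B (\<i> *s x) (\<i> *s y) = B x y"
    "\<And>x. shifted_product M zs x = 0 \<Longrightarrow> \<eta> * (norm x)\<^sup>2 \<le> B x (M *v x - c *\<^sub>R x)"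
    "\<And>x. \<forall>z\<in>set zs. Re z < c \<Longrightarrow> shifted_product M zs x = 0 \<Longrightarrow> B x x \<le> - (norm x)\<^sup>2"
    by auto
  define D where "D x = M *v x - z *s x" for x
  define s :: real where "s = (if Re z < c then -1 else 1)"
  define K where "K = 1 / (4 * \<eta>\<^sup>2)"
  define E where "E x y = s * (x \<bullet> y) + K * B (D x) (D y)" for x y
  have "K > 0"
    using assms(1) by (simp add: K_def)
  have D_add: "D (x + y) = D x + D y" for x y
    by (simp add: D_def matrix_vector_right_distrib vector_add_ldistrib)
  have D_scaleR: "D (r *\<^sub>R x) = r *\<^sub>R D x" for r x
    by (simp add: D_def flip: of_real_vector_scale)
      (simp add: vector_scalar_commute vector_ssub_ldistrib vector_smult_assoc mult.commute)
  have D_scale: "D (a *s x) = a *s D x" for a x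
    by (simp add: D_def vector_scalar_commute vector_ssub_ldistrib vector_smult_assoc mult.commute)
  have D_M: "D (M *v x) = M *v D x" for x
    by (simp add: D_def matrix_vector_mult_diff_distrib vector_scalar_commute)
  have D_diff: "D (x - y) = D x - D y" for x y
    using D_add[of "x - y" y] by simp
  have "bilinear E"
    using B(1) unfolding bilinear_def linear_iff E_def D_add D_scaleR
    by (simp add: inner_add_left inner_add_right algebra_simps)
  moreover have "E x y = E y x" for x y
    by (simp add: E_def inner_commute B(2))
  moreover have "E (\<i> *s x) (\<i> *s y) = E x y" for x y
    by (simp add: E_def D_scale B(3) inner_imaginary_unit_scale)
  moreover have "\<eta> * (norm x)\<^sup>2 \<le> E x (M *v x - c *\<^sub>R x)"
    if "shifted_product M (z # zs) x = 0" for x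
  proof -
    define y where "y = D x"
    have "M *v x - c *\<^sub>R x = y + (z - complex_of_real c) *s x"
      by (simp add: y_def D_def vector_sub_rdistrib of_real_vector_scale)
    then have "x \<bullet> (M *v x - c *\<^sub>R x) = x \<bullet> y + (Re z - c) * (norm x)\<^sup>2"
      by (simp only: inner_add_right inner_complex_vector_scale) simp
    moreover have "E x (M *v x - c *\<^sub>R x)
        = s * (x \<bullet> (M *v x - c *\<^sub>R x)) + K * B y (M *v y - c *\<^sub>R y)"
      by (simp only: E_def D_diff D_M D_scaleR y_def)
    ultimately have "E x (M *v x - c *\<^sub>R x)
        = s * (x \<bullet> y) + s * (Re z - c) * (norm x)\<^sup>2 + K * B y (M *v y - c *\<^sub>R y)"
      by (simp add: distrib_left mult.assoc)
    moreover have "s * (x \<bullet> y) \<ge> - (norm x * norm y)"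
      using Cauchy_Schwarz_ineq2[of x y] by (auto simp: s_def)
    moreover have "s * (Re z - c) * (norm x)\<^sup>2 \<ge> 2 * \<eta> * (norm x)\<^sup>2"
      using Cons.prems by (intro mult_right_mono) (auto simp: s_def abs_if split: if_splits)
    moreover have "K * B y (M *v y - c *\<^sub>R y) \<ge> K * (\<eta> * (norm y)\<^sup>2)"
      using that \<open>K > 0\<close> by (intro mult_left_mono B(4)) (auto simp: y_def D_def)
    \<comment> \<open>The weight \<open>K\<close> completes the square: the loss from \<open>x \<bullet> y\<close> is exactly covered.\<close>
    moreover have "\<eta> * (norm x)\<^sup>2 - norm x * norm y + K * (\<eta> * (norm y)\<^sup>2)
        = \<eta> * (norm x - norm y / (2 * \<eta>))\<^sup>2"
      using assms(1) by (simp add: K_def field_simps power2_eq_square)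
    moreover have "\<eta> * (norm x - norm y / (2 * \<eta>))\<^sup>2 \<ge> 0"
      using assms(1) by simp
    ultimately show ?thesis
      by linarith
  qed
  moreover have "E x x \<le> - (norm x)\<^sup>2"
    if "\<forall>z\<in>set (z # zs). Re z < c" "shifted_product M (z # zs) x = 0" for x
  proof -
    have "B (D x) (D x) \<le> - (norm (D x))\<^sup>2"
      using that by (intro B(5)) (auto simp: D_def)
    then have "K * B (D x) (D x) \<le> 0"
      using \<open>K > 0\<close> by (intro mult_nonneg_nonpos) (auto intro: order_trans)
    then show ?thesis
      using that by (simp add: E_def s_def power2_norm_eq_inner)
  qed
  ultimately show ?case
    by (intro exI[of _ E]) blast
qed

definition complexify :: "real^'m \<Rightarrow> complex^'m" where
  "complexify x = (\<chi> i. complex_of_real (x $ i))"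

lemma complexify_simps [simp]: "complexify x $ i = complex_of_real (x $ i)"
  by (simp add: complexify_def)

lemma norm_complexify: "norm (complexify x) = norm x"
  by (simp add: norm_vec_def)

lemma map_matrix_complexify:
  "map_matrix complex_of_real A *v complexify x = complexify (A *v x)"
  by (simp add: vec_eq_iff matrix_vector_mult_def)

text \<open>A simultaneous Lyapunov and Chetaev function for the linear field \<open>A\<close>, whose spectrum
  is split by the line \<open>Re = c\<close>. It is the form of the complexified matrix, restricted to
  real vectors. That it takes a positive value when some eigenvalue \<open>\<mu>\<close> lies to the right
  of the line is read off from an eigenvector \<open>v = a + \<i> b\<close>: the growth inequality gives
  \<open>(Re \<mu> - c) B v v > 0\<close>, the same holds for the conjugate vector, and the parallelogram
  law turns the sum of the two values into \<open>2 (Q a a + Q b b)\<close>.\<close>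

theorem spectral_gap_energy_form:
  fixes A :: "real^'m^'m"
  assumes "c \<notin> Re ` eigenvalues A"
  shows "\<exists>Q \<eta>. bilinear Q \<and> (\<forall>x y. Q x y = Q y x) \<and> \<eta> > 0 \<and>
    (\<forall>x. \<eta> * (norm x)\<^sup>2 \<le> Q x (A *v x - c *\<^sub>R x)) \<and>
    ((\<forall>\<mu>\<in>eigenvalues A. Re \<mu> < c) \<longrightarrow> (\<forall>x. Q x x \<le> - (norm x)\<^sup>2)) \<and>
    ((\<exists>\<mu>\<in>eigenvalues A. Re \<mu> > c) \<longrightarrow> (\<exists>x. Q x x > 0))"
proof -
  define M where "M = map_matrix complex_of_real A"
  obtain zs where zs: "set zs = eigenvalues A" "\<And>v. shifted_product M zs v = 0"
    unfolding eigenvalues_def M_def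
    using spectral_annihilating_list[of "map_matrix complex_of_real A"] by blast
  obtain \<eta> where \<eta>: "\<eta> > 0" "\<forall>z\<in>eigenvalues A. 2 * \<eta> \<le> \<bar>Re z - c\<bar>"
  proof
    let ?m = "Min ((\<lambda>z. \<bar>Re z - c\<bar>) ` eigenvalues A)"
    show "?m / 2 > 0"
      using assms finite_eigenvalues eigenvalues_nonempty[of A] by (auto simp: finite_eigenvalues)
    show "\<forall>z\<in>eigenvalues A. 2 * (?m / 2) \<le> \<bar>Re z - c\<bar>"
      by (simp add: finite_eigenvalues)
  qed
  obtain B where B: "bilinear B" "\<And>x y. B x y = B y x" "\<And>x y. B (\<i> *s x) (\<i> *s y) = B x y"
    "\<And>x. \<eta> * (norm x)\<^sup>2 \<le> B x (M *v x - c *\<^sub>R x)"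
    "\<And>x. \<forall>z\<in>eigenvalues A. Re z < c \<Longrightarrow> B x x \<le> - (norm x)\<^sup>2"
    using chain_energy_form[of \<eta> zs c M] \<eta> zs by auto
  define Q where "Q x y = B (complexify x) (complexify y)" for x y
  have complexify: "complexify (x + y) = complexify x + complexify y"
    "complexify (r *\<^sub>R x) = r *\<^sub>R complexify x" "complexify (x - y) = complexify x - complexify y"
    for x y r
    by (simp_all add: vec_eq_iff scaleR_conv_of_real[where 'a=complex])
  have Bsimps: "B (x + y) u = B x u + B y u" "B x (u + v) = B x u + B x v"
    "B (r *\<^sub>R x) u = r * B x u" "B x (r *\<^sub>R u) = r * B x u"
    "B (- x) u = - B x u" "B x (- u) = - B x u"
    "B (x - y) u = B x u - B y u" "B x (u - v) = B x u - B x v" for x y u v r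
    using B(1) by (auto simp: bilinear_ladd bilinear_radd bilinear_lmul bilinear_rmul
        bilinear_lneg bilinear_rneg bilinear_lsub bilinear_rsub)
  have "bilinear Q"
    unfolding bilinear_def linear_iff Q_def by (simp add: complexify Bsimps)
  moreover have "Q x y = Q y x" for x y
    by (simp add: Q_def B(2))
  moreover have "\<eta> * (norm x)\<^sup>2 \<le> Q x (A *v x - c *\<^sub>R x)" for x
    using B(4)[of "complexify x"]
    by (simp add: Q_def norm_complexify M_def map_matrix_complexify complexify)
  moreover have "Q x x \<le> - (norm x)\<^sup>2" if "\<forall>z\<in>eigenvalues A. Re z < c" for x
    using B(5)[OF that, of "complexify x"] by (simp add: Q_def norm_complexify)
  moreover have "\<exists>x. Q x x > 0" if \<mu>: "\<mu> \<in> eigenvalues A" "Re \<mu> > c" for \<mu>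
  proof -
    have B_imaginary: "B w (\<i> *s w) = 0" for w
    proof -
      have "B w (\<i> *s w) = B (\<i> *s w) (\<i> *s (\<i> *s w))"
        by (rule B(3)[symmetric])
      also have "\<i> *s (\<i> *s w) = - w"
        by (simp add: vec_eq_iff)
      finally show ?thesis
        using B(2)[of w "\<i> *s w"] by (simp add: Bsimps)
    qed
    have positive: "B w w > 0" if "w \<noteq> 0" "M *v w = z *s w" "Re z > c" for w z
    proof -
      have "M *v w - c *\<^sub>R w = (Re z - c) *\<^sub>R w + Im z *\<^sub>R (\<i> *s w)"
        unfolding that(2) by (simp add: vec_eq_iff complex_eq_iff algebra_simps)
      then have "\<eta> * (norm w)\<^sup>2 \<le> (Re z - c) * B w w"
        using B(4)[of w] by (simp add: Bsimps B_imaginary)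
      moreover have "\<eta> * (norm w)\<^sup>2 > 0"
        using \<eta>(1) that(1) by simp
      ultimately have "(Re z - c) * B w w > 0"
        by linarith
      then show ?thesis
        using that(3) by (simp add: zero_less_mult_iff)
    qed
    obtain v where v: "v \<noteq> 0" "M *v v = \<mu> *s v"
      using \<mu>(1) by (auto simp: eigenvalues_def M_def)
    define a b where "a = (\<chi> i. Re (v $ i))" and "b = (\<chi> i. Im (v $ i))"
    define v' where "v' = (\<chi> i. cnj (v $ i))"
    have "v' \<noteq> 0"
      using v(1) by (auto simp: v'_def vec_eq_iff)
    have "(M *v v') $ i = cnj ((M *v v) $ i)" for i
      by (simp add: matrix_vector_mult_def M_def v'_def)
    then have "M *v v' = cnj \<mu> *s v'"
      by (simp add: v(2) vec_eq_iff v'_def)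
    then have "B v v + B v' v' > 0"
      using positive[of v \<mu>] positive[of v' "cnj \<mu>"] v \<open>v' \<noteq> 0\<close> \<mu>(2) by simp
    moreover have "v = complexify a + \<i> *s complexify b" "v' = complexify a - \<i> *s complexify b"
      by (simp_all add: a_def b_def v'_def vec_eq_iff complex_eq_iff)
    then have "B v v + B v' v' = 2 * (Q a a + Q b b)"
      by (simp add: Bsimps B(3) Q_def)
    ultimately have "Q a a > 0 \<or> Q b b > 0"
      by (simp only:) (smt (verit))
    then show ?thesis
      by blast
  qed
  ultimately show ?thesis
    using \<eta>(1) by (intro exI[of _ Q] exI[of _ \<eta>]) blast
qed

section \<open>Global solutions of bounded Lipschitz fields\<close>

text \<open>Picard iteration on the whole half line at once. In the unknown \<open>y t = exp (- k t) x t\<close>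
  the integral operator maps bounded continuous functions to bounded continuous functions,
  because \<open>h\<close> is bounded, and for \<open>k = 2 L\<close> it contracts by \<open>1/2\<close>, where
  \<open>L\<close> is a Lipschitz constant of \<open>h\<close>.\<close>

lemma bounded_lipschitz_solution_exists:
  fixes h :: "'a::euclidean_space \<Rightarrow> 'a"
  assumes lipschitz: "K-lipschitz_on UNIV h" and bounded: "\<And>y. norm (h y) \<le> B"
  shows "\<exists>x. solves_on h x {0..} \<and> x 0 = x0"
proof -
  \<comment> \<open>The increment keeps the rate \<open>k\<close> positive when \<open>K = 0\<close>.\<close>
  define L where "L = K + 1"
  have "L > 0"
    using lipschitz_on_nonneg[OF lipschitz] by (simp add: L_def)
  have h_lipschitz: "norm (h x - h y) \<le> L * norm (x - y)" for x y
  proof -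
    have "norm (h x - h y) \<le> K * norm (x - y)"
      using lipschitz_onD[OF lipschitz, of x y] by (simp add: dist_norm)
    then show ?thesis
      by (simp add: L_def distrib_right add_increasing2)
  qed
  have h_continuous: "continuous_on UNIV h"
    using lipschitz by (rule lipschitz_on_continuous_on)
  have "B \<ge> 0"
    using bounded[of 0] norm_ge_zero order_trans by blast
  define k where "k = 2 * L"
  have "k > 0"
    using \<open>L > 0\<close> by (simp add: k_def)
  define rhs where "rhs y s = h (exp (k * s) *\<^sub>R apply_bcontfun y s)" for y :: "real \<Rightarrow>\<^sub>C 'a" and s
  define I where "I y \<tau> = integral {0..\<tau>} (rhs y)" for y \<tau>
  \<comment> \<open>The maximum extends the operator constantly to negative times, since the Banach space consists of functions on the whole line.\<close>
  define F where "F y t = exp (- (k * max t 0)) *\<^sub>R (x0 + I y (max t 0))" for y t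
  have rhs_continuous: "continuous_on S (rhs y)" for y S
    unfolding rhs_def
    by (intro continuous_on_compose2[OF h_continuous] continuous_intros) auto
  then have rhs_integrable: "rhs y integrable_on {0..\<tau>}" for y \<tau>
    by (intro integrable_continuous_real)
  have I_deriv: "(I y has_vector_derivative rhs y t) (at t within {0..})" if "t \<ge> 0" for y t
  proof -
    have "(I y has_vector_derivative rhs y t) (at t within {0..t + 1})"
      unfolding I_def using that rhs_continuous by (intro integral_has_vector_derivative) auto
    moreover have "at t within {0..t + 1} = at t within {0..}"
      using that by (intro at_within_nhd[of _ "{..<t + 1}"]) auto
    ultimately show ?thesis
      by simp
  qed
  have I_continuous: "continuous_on {0..} (I y)" for y
    using I_deriv by (intro continuous_on_vector_derivative) auto
  have F_continuous: "continuous_on UNIV (F y)" for y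
    unfolding F_def
    by (intro continuous_intros continuous_on_compose2[OF I_continuous]) auto
  have F_bounded: "norm (F y t) \<le> norm x0 + B / k" for y t
  proof -
    define \<tau> :: real where "\<tau> = max t 0"
    have exp_ge_self: "k * \<tau> \<le> exp (k * \<tau>)"
      using exp_ge_add_one_self[of "k * \<tau>"] by linarith
    have "norm (I y \<tau>) \<le> integral {0..\<tau>} (\<lambda>_. B)"
      unfolding I_def
      by (intro Henstock_Kurzweil_Integration.integral_norm_bound_integral rhs_integrable)
        (auto simp: rhs_def bounded)
    also have "\<dots> = B * \<tau>"
      by (simp add: \<tau>_def)
    also have "\<dots> = B / k * (k * \<tau>)"
      using \<open>k > 0\<close> by simp
    also have "\<dots> \<le> B / k * exp (k * \<tau>)"
      using \<open>k > 0\<close> \<open>B \<ge> 0\<close> exp_ge_self by (intro mult_left_mono) auto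
    finally have "norm (x0 + I y \<tau>) \<le> norm x0 * 1 + B / k * exp (k * \<tau>)"
      using norm_triangle_ineq[of x0 "I y \<tau>"] by simp
    also have "\<dots> \<le> norm x0 * exp (k * \<tau>) + B / k * exp (k * \<tau>)"
      using \<open>k > 0\<close> \<open>B \<ge> 0\<close> by (intro add_mono mult_left_mono) (auto simp: \<tau>_def)
    finally have "norm (x0 + I y \<tau>) \<le> (norm x0 + B / k) * exp (k * \<tau>)"
      by (simp add: distrib_right)
    moreover have "norm (F y t) = norm (x0 + I y \<tau>) / exp (k * \<tau>)"
      by (simp add: F_def \<tau>_def exp_minus divide_inverse mult.commute)
    ultimately show ?thesis
      by (simp add: pos_divide_le_eq)
  qed
  define \<Phi> where "\<Phi> y = Bcontfun (F y)" for y
  have \<Phi>: "apply_bcontfun (\<Phi> y) = F y" for y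
    unfolding \<Phi>_def using bcontfun_normI[OF F_continuous F_bounded] by (rule Bcontfun_inverse)
  have contraction: "dist (\<Phi> y) (\<Phi> z) \<le> 1 / 2 * dist y z" for y z
  proof (rule dist_bound)
    fix t
    define \<tau> :: real where "\<tau> = max t 0"
    define d where "d = dist y z"
    have "((\<lambda>s. L * d * exp (k * s)) has_integral
        L * d / k * exp (k * \<tau>) - L * d / k * exp (k * 0)) {0..\<tau>}"
      using \<open>k > 0\<close>
      by (intro fundamental_theorem_of_calculus)
        (auto simp: \<tau>_def has_real_derivative_iff_has_vector_derivative[symmetric]
          intro!: derivative_eq_intros)
    then have exp_integral:
        "((\<lambda>s. L * d * exp (k * s)) has_integral L * d / k * (exp (k * \<tau>) - 1)) {0..\<tau>}"
      by (simp add: right_diff_distrib)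
    have "I y \<tau> - I z \<tau> = integral {0..\<tau>} (\<lambda>s. rhs y s - rhs z s)"
      unfolding I_def by (intro integral_diff[symmetric] rhs_integrable)
    also have "norm \<dots> \<le> integral {0..\<tau>} (\<lambda>s. L * d * exp (k * s))"
    proof (intro Henstock_Kurzweil_Integration.integral_norm_bound_integral has_integral_integrable[OF exp_integral])
      show "norm (rhs y s - rhs z s) \<le> L * d * exp (k * s)" for s
      proof -
        have "norm (rhs y s - rhs z s)
            \<le> L * norm (exp (k * s) *\<^sub>R apply_bcontfun y s - exp (k * s) *\<^sub>R apply_bcontfun z s)"
          unfolding rhs_def by (rule h_lipschitz)
        also have "\<dots> = L * (exp (k * s) * dist (apply_bcontfun y s) (apply_bcontfun z s))"
          by (simp add: dist_norm flip: scaleR_diff_right)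
        also have "\<dots> \<le> L * (exp (k * s) * d)"
          using \<open>L > 0\<close> dist_bounded[of y s z] by (intro mult_left_mono) (auto simp: d_def)
        finally show ?thesis
          by (simp add: mult_ac)
      qed
    qed (intro integrable_diff rhs_integrable)
    also have "\<dots> = L * d / k * (exp (k * \<tau>) - 1)"
      by (rule integral_unique[OF exp_integral])
    also have "L * d / k = d / 2"
      using \<open>L > 0\<close> by (simp add: k_def)
    also have "d / 2 * (exp (k * \<tau>) - 1) \<le> d / 2 * exp (k * \<tau>)"
      by (intro mult_left_mono) (auto simp: d_def)
    finally have "norm (I y \<tau> - I z \<tau>) \<le> d / 2 * exp (k * \<tau>)" .
    moreover have "dist (apply_bcontfun (\<Phi> y) t) (apply_bcontfun (\<Phi> z) t)
        = norm (I y \<tau> - I z \<tau>) / exp (k * \<tau>)"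
      by (simp add: \<Phi> F_def dist_norm exp_minus divide_inverse mult.commute
          flip: \<tau>_def scaleR_diff_right)
    ultimately show "dist (apply_bcontfun (\<Phi> y) t) (apply_bcontfun (\<Phi> z) t) \<le> 1 / 2 * dist y z"
      by (simp add: pos_divide_le_eq d_def)
  qed
  obtain y where y: "\<Phi> y = y"
    using banach_fix_type[of "1 / 2" \<Phi>] contraction by auto
  define x where "x t = exp (k * t) *\<^sub>R apply_bcontfun y t" for t
  have x: "x t = x0 + I y t" if "t \<ge> 0" for t
  proof -
    have "apply_bcontfun y t = F y t"
      using \<Phi>[of y] y by simp
    then show ?thesis
      using that by (simp add: x_def F_def max_def exp_minus)
  qed
  have "(x has_vector_derivative h (x t)) (at t within {0..})" if "t \<ge> 0" for t
  proof -
    have "((\<lambda>t. x0 + I y t) has_vector_derivative h (x t)) (at t within {0..})"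
      using I_deriv[OF that, of y] by (auto simp: rhs_def x_def intro!: derivative_eq_intros)
    then show ?thesis
      by (rule has_vector_derivative_transform[rotated 2]) (use that x in auto)
  qed
  moreover have "x 0 = x0"
    using x[of 0] by (simp add: I_def)
  ultimately show ?thesis
    by (auto simp: solves_on_def)
qed

text \<open>Composition with the nearest-point projection makes a field that is Lipschitz on a ball bounded
  and globally Lipschitz, without changing it on the ball.\<close>

lemma truncated_field_solution_exists:
  fixes g :: "'a::euclidean_space \<Rightarrow> 'a"
  assumes "K-lipschitz_on (cball 0 \<rho>) g" "\<rho> > 0"
  shows "\<exists>x. solves_on (g \<circ> closest_point (cball 0 \<rho>)) x {0..} \<and> x 0 = x0"
proof -
  have range: "closest_point (cball 0 \<rho>) y \<in> cball 0 \<rho>" for y :: 'a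
    using assms(2) by (intro closest_point_in_set) auto
  have "1-lipschitz_on UNIV (closest_point (cball (0::'a) \<rho>))"
    using assms(2) by (intro lipschitz_onI) (auto intro: closest_point_lipschitz)
  then have "(K * 1)-lipschitz_on UNIV (g \<circ> closest_point (cball 0 \<rho>))"
    using assms(1) range by (intro lipschitz_on_compose) (auto intro: lipschitz_on_subset)
  moreover have "compact (g ` cball 0 \<rho>)"
    using lipschitz_on_continuous_on[OF assms(1)] by (intro compact_continuous_image) auto
  then obtain B where "\<forall>y\<in>g ` cball 0 \<rho>. norm y \<le> B"
    using compact_imp_bounded bounded_iff by metis
  ultimately show ?thesis
    using range by (intro bounded_lipschitz_solution_exists[of _ _ B]) auto
qed

section \<open>Stability from the linearization\<close>

lemma exponential_lower_comparison:
  fixes u :: "real \<Rightarrow> real"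
  assumes "0 \<le> t" and "continuous_on {0..t} u"
    and deriv: "\<And>s. 0 < s \<Longrightarrow> s < t \<Longrightarrow> (u has_real_derivative u' s) (at s)"
    and ineq: "\<And>s. 0 < s \<Longrightarrow> s < t \<Longrightarrow> a * u s \<le> u' s"
  shows "exp (a * t) * u 0 \<le> u t"
proof -
  define w where "w s = exp (- (a * s)) * u s" for s
  have "w 0 \<le> w t"
  proof (rule DERIV_nonneg_imp_increasing_open[OF assms(1)])
    fix s assume s: "0 < s" "s < t"
    have "(w has_real_derivative exp (- (a * s)) * (u' s - a * u s)) (at s)"
      unfolding w_def using deriv[OF s]
      by (auto intro!: derivative_eq_intros simp: algebra_simps)
    moreover have "exp (- (a * s)) * (u' s - a * u s) \<ge> 0"
      using ineq[OF s] by simp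
    ultimately show "\<exists>y. (w has_real_derivative y) (at s) \<and> y \<ge> 0"
      by blast
  next
    show "continuous_on {0..t} w"
      unfolding w_def by (intro continuous_intros assms(2))
  qed
  then show ?thesis
    by (simp add: w_def exp_minus field_simps)
qed

lemma solves_on_subset: "solves_on g x J \<Longrightarrow> J' \<subseteq> J \<Longrightarrow> solves_on g x J'"
  unfolding solves_on_def by (meson has_vector_derivative_within_subset subsetD)

lemma energy_growth_along_solution:
  fixes g :: "'a::euclidean_space \<Rightarrow> 'a" and Q :: "'a \<Rightarrow> 'a \<Rightarrow> real"
  assumes "bilinear Q" "\<And>x y. Q x y = Q y x"
    and ineq: "\<And>y. norm y \<le> \<rho> \<Longrightarrow> c * Q y y \<le> Q y (g y)"
    and "solves_on g x {0..t}" "0 \<le> t" "\<And>s. 0 < s \<Longrightarrow> s < t \<Longrightarrow> norm (x s) \<le> \<rho>"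
  shows "exp (2 * c * t) * Q (x 0) (x 0) \<le> Q (x t) (x t)"
proof -
  have bounded: "bounded_bilinear Q"
    using assms(1) by (simp add: bilinear_conv_bounded_bilinear)
  have deriv: "((\<lambda>s. Q (x s) (x s)) has_vector_derivative 2 * Q (x s) (g (x s))) (at s within {0..t})"
    if "s \<in> {0..t}" for s
  proof -
    have "(x has_vector_derivative g (x s)) (at s within {0..t})"
      using assms(4) that by (simp add: solves_on_def)
    from bounded_bilinear.has_vector_derivative[OF bounded this this] show ?thesis
      by (simp add: assms(2)[of "g (x s)"])
  qed
  show ?thesis
  proof (rule exponential_lower_comparison[where u = "\<lambda>s. Q (x s) (x s)"])
    show "continuous_on {0..t} (\<lambda>s. Q (x s) (x s))"
      using deriv by (rule continuous_on_vector_derivative)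
    fix s assume s: "0 < s" "s < t"
    then show "((\<lambda>s. Q (x s) (x s)) has_real_derivative 2 * Q (x s) (g (x s))) (at s)"
      using deriv[of s] at_within_Icc_at[of 0 s t]
      by (simp add: has_real_derivative_iff_has_vector_derivative)
    show "2 * c * Q (x s) (x s) \<le> 2 * Q (x s) (g (x s))"
      using ineq[OF assms(6)[OF s]] by simp
  qed fact
qed

text \<open>The margin \<open>\<eta>\<close> in the linear inequality pays for the nonlinear remainder
  \<open>g y - A y\<close>, which is \<open>o(|y|)\<close> at the equilibrium.\<close>

lemma energy_inequality_near_equilibrium:
  fixes g A :: "'a::euclidean_space \<Rightarrow> 'a" and Q :: "'a \<Rightarrow> 'a \<Rightarrow> real"
  assumes "bilinear Q" "\<eta> > 0" "\<And>x. \<eta> * (norm x)\<^sup>2 \<le> Q x (A x - c *\<^sub>R x)"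
    and "(g has_derivative A) (at 0)" "g 0 = 0" "r > 0"
  obtains \<rho> where "\<rho> > 0" "\<rho> \<le> r" "\<And>y. norm y \<le> \<rho> \<Longrightarrow> c * Q y y \<le> Q y (g y)"
proof -
  obtain K where K: "K > 0" "\<And>x y. norm (Q x y) \<le> K * norm x * norm y"
    using bilinear_bounded_pos[OF assms(1)] by metis
  have "\<eta> / K > 0"
    using K assms(2) by simp
  then obtain d where d: "d > 0" "\<And>y. norm y < d \<Longrightarrow> norm (g y - A y) \<le> \<eta> / K * norm y"
    using assms(4,5) unfolding has_derivative_within_alt by fastforce
  show ?thesis
  proof
    show "min (d / 2) r > 0" "min (d / 2) r \<le> r"
      using d assms(6) by auto
    fix y :: 'a assume "norm y \<le> min (d / 2) r"
    then have "norm (g y - A y) \<le> \<eta> / K * norm y"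
      using d by auto
    then have "K * norm y * norm (g y - A y) \<le> K * norm y * (\<eta> / K * norm y)"
      using K(1) by (intro mult_left_mono) auto
    then have "\<bar>Q y (g y - A y)\<bar> \<le> \<eta> * (norm y)\<^sup>2"
      using K(1) K(2)[of y "g y - A y"] by (simp add: power2_eq_square mult.left_commute)
    moreover have "Q y (g y) = Q y (A y - c *\<^sub>R y) + Q y (g y - A y) + c * Q y y"
      using assms(1) by (simp add: bilinear_rsub bilinear_rmul)
    ultimately show "c * Q y y \<le> Q y (g y)"
      using assms(3)[of y] by linarith
  qed
qed

text \<open>Chetaev's argument. Stability would provide, for a small initial value in the open cone where
  the form is positive, a global solution that stays near the origin. Choosing \<open>c > 0\<close>
  below \<open>Re \<mu>\<close> and off the spectrum, the form grows along this solution at least like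
  \<open>exp (2 c t)\<close>, although it is bounded near the origin. Eigenvalues on the imaginary axis
  do no harm, since the line \<open>Re = c\<close> avoids them.\<close>

theorem unstable_if_eigenvalue_positive:
  fixes A :: "real^'m^'m"
  assumes "(g has_derivative (*v) A) (at 0)" "g 0 = 0"
    and "\<mu> \<in> eigenvalues A" "Re \<mu> > 0"
  shows "\<not> lyapunov_stable g 0"
proof
  assume stable: "lyapunov_stable g 0"
  have "infinite {0<..<Re \<mu>}"
    using assms(4) by simp
  then obtain c where c: "0 < c" "c < Re \<mu>" "c \<notin> Re ` eigenvalues A"
    using finite_eigenvalues[of A] by (metis finite_imageI finite_subset greaterThanLessThan_iff subsetI)
  have "\<exists>\<mu>\<in>eigenvalues A. Re \<mu> > c"
    using assms(3) c(2) by blast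
  then obtain Q \<eta> where Q: "bilinear Q" "\<And>x y. Q x y = Q y x" "\<eta> > 0"
    "\<And>x. \<eta> * (norm x)\<^sup>2 \<le> Q x (A *v x - c *\<^sub>R x)" "\<exists>x. Q x x > 0"
    using spectral_gap_energy_form[OF c(3)] by blast
  obtain \<rho> where \<rho>: "\<rho> > 0" "\<And>y. norm y \<le> \<rho> \<Longrightarrow> c * Q y y \<le> Q y (g y)"
    using energy_inequality_near_equilibrium[OF Q(1,3,4) assms(1,2), of 1] by auto
  obtain \<delta> where \<delta>: "\<delta> > 0" "\<And>x0. norm x0 < \<delta> \<Longrightarrow>
      (\<exists>x. solves_on g x {0..} \<and> x 0 = x0) \<and>
      (\<forall>x T. solves_on g x {0..<T} \<and> x 0 = x0 \<longrightarrow> (\<forall>t\<in>{0..<T}. norm (x t) < \<rho>))"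
    using stable \<rho>(1) unfolding lyapunov_stable_def by (metis diff_zero)
  obtain a where a: "Q a a > 0"
    using Q(5) by blast
  define x0 where "x0 = (\<delta> / (2 * norm a + 1)) *\<^sub>R a"
  have "norm x0 < \<delta>"
    using \<delta>(1) by (auto simp: x0_def field_simps add_pos_nonneg)
  then obtain x where x: "solves_on g x {0..}" "x 0 = x0"
    using \<delta>(2) by blast
  have bounded: "norm (x t) < \<rho>" if "t \<ge> 0" for t
  proof -
    have "solves_on g x {0..<t + 1}"
      using x(1) by (rule solves_on_subset) auto
    then show ?thesis
      using \<delta>(2)[OF \<open>norm x0 < \<delta>\<close>] x(2) that by auto
  qed
  have pos: "Q x0 x0 > 0"
    using a \<delta>(1) Q(1) by (simp add: x0_def bilinear_lmul bilinear_rmul add_nonneg_pos)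
  obtain K where K: "K > 0" "\<And>x y. norm (Q x y) \<le> K * norm x * norm y"
    using bilinear_bounded_pos[OF Q(1)] by metis
  \<comment> \<open>At this time \<open>2 c t Q x0 x0\<close> equals the bound \<open>K \<rho>\<^sup>2\<close> of the form near the origin, and \<open>exp (2 c t)\<close> exceeds \<open>2 c t\<close>.\<close>
  define t where "t = K * \<rho> * \<rho> / (2 * c * Q x0 x0)"
  have "t \<ge> 0"
    using c pos K \<rho> by (simp add: t_def)
  have "exp (2 * c * t) * Q x0 x0 \<le> Q (x t) (x t)"
    using energy_growth_along_solution[OF Q(1,2) \<rho>(2) solves_on_subset[OF x(1)] \<open>t \<ge> 0\<close>]
      bounded x(2) by (auto simp: less_imp_le)
  also have "\<dots> \<le> K * norm (x t) * norm (x t)"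
    using K(2)[of "x t" "x t"] by simp
  also have "\<dots> \<le> K * \<rho> * \<rho>"
    using K(1) \<rho>(1) bounded[OF \<open>t \<ge> 0\<close>] by (intro mult_mono) auto
  also have "\<dots> = 2 * c * t * Q x0 x0"
    using c pos by (simp add: t_def)
  finally have "exp (2 * c * t) \<le> 2 * c * t"
    using pos by simp
  then show False
    using exp_ge_add_one_self[of "2 * c * t"] by linarith
qed

text \<open>As long as a solution stays in the ball of radius \<open>\<rho>\<close>, the energy inequality gives the
  estimate; at the first time of leaving, that estimate would keep it strictly inside. Hence it
  never leaves.\<close>

lemma energy_decay_along_solution:
  fixes g :: "'a::euclidean_space \<Rightarrow> 'a" and Q :: "'a \<Rightarrow> 'a \<Rightarrow> real"
  assumes Q: "bilinear Q" "\<And>x y. Q x y = Q y x" "\<And>y. Q y y \<le> - (norm y)\<^sup>2"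
      "\<And>y. \<bar>Q y y\<bar> \<le> (C * norm y)\<^sup>2"
    and ineq: "\<And>y. norm y \<le> \<rho> \<Longrightarrow> c * Q y y \<le> Q y (g y)"
    and "c < 0" "C > 0" "C * norm (x 0) < \<rho>"
    and sol: "solves_on g x {0..<T}" and t: "t \<in> {0..<T}"
  shows "norm (x t) \<le> C * exp (c * t) * norm (x 0)" "norm (x t) < \<rho>"
proof -
  have decay: "norm (x t) \<le> C * exp (c * t) * norm (x 0)"
    if "t \<in> {0..<T}" "\<And>s. 0 < s \<Longrightarrow> s < t \<Longrightarrow> norm (x s) \<le> \<rho>" for t
  proof -
    have "exp (2 * c * t) * Q (x 0) (x 0) \<le> Q (x t) (x t)"
      using that by (intro energy_growth_along_solution[OF Q(1,2) ineq] solves_on_subset[OF sol]) auto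
    then have "(norm (x t))\<^sup>2 \<le> exp (2 * c * t) * - Q (x 0) (x 0)"
      using Q(3)[of "x t"] by simp
    also have "\<dots> \<le> exp (2 * c * t) * (C * norm (x 0))\<^sup>2"
      using Q(4)[of "x 0"] by (intro mult_left_mono) auto
    also have "\<dots> = (C * exp (c * t) * norm (x 0))\<^sup>2"
      by (simp add: power_mult_distrib mult_ac flip: exp_double)
    finally show ?thesis
      by (rule power2_le_imp_le) (use \<open>C > 0\<close> in auto)
  qed
  have decay': "norm (x t) < \<rho>"
    if "t \<in> {0..<T}" "\<And>s. 0 < s \<Longrightarrow> s < t \<Longrightarrow> norm (x s) \<le> \<rho>" for t
  proof -
    have "C * exp (c * t) * norm (x 0) = exp (c * t) * (C * norm (x 0))"
      by simp
    also have "\<dots> \<le> C * norm (x 0)"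
      using that(1) \<open>c < 0\<close> \<open>C > 0\<close> by (intro mult_left_le_one_le) (auto simp: mult_nonpos_nonneg)
    finally show ?thesis
      using decay[OF that] \<open>C * norm (x 0) < \<rho>\<close> by linarith
  qed
  have inside: "norm (x t) < \<rho>" if t: "t \<in> {0..<T}" for t
  proof (rule ccontr)
    assume "\<not> norm (x t) < \<rho>"
    define S where "S = {0..t} \<inter> (\<lambda>s. norm (x s)) -` {\<rho>..}"
    have "continuous_on {0..t} x"
      using solves_on_subset[OF sol, of "{0..t}"] t
      by (intro continuous_on_vector_derivative[of _ x "\<lambda>s. g (x s)"])
        (simp add: solves_on_def subset_iff)
    then have "closed S"
      unfolding S_def by (intro continuous_closed_preimage continuous_intros) auto
    moreover have "bounded S"
      by (rule bounded_subset[OF bounded_closed_interval[of 0 t]]) (auto simp: S_def)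
    ultimately have "compact S"
      by (simp add: compact_eq_bounded_closed)
    moreover have "t \<in> S"
      using t \<open>\<not> norm (x t) < \<rho>\<close> by (auto simp: S_def)
    ultimately obtain s where s: "s \<in> S" "\<forall>s'\<in>S. s \<le> s'"
      using compact_attains_inf[of S] by auto
    have "norm (x s) < \<rho>"
    proof (rule decay')
      show "s \<in> {0..<T}"
        using s(1) t by (auto simp: S_def)
      show "norm (x s') \<le> \<rho>" if "0 < s'" "s' < s" for s'
      proof -
        have "s' \<notin> S"
          using s(2) that by force
        then show ?thesis
          using s(1) that by (auto simp: S_def)
      qed
    qed
    then show False
      using s(1) by (simp add: S_def)
  qed
  show "norm (x t) \<le> C * exp (c * t) * norm (x 0)"
    using t inside by (intro decay) (auto simp: less_imp_le)
  show "norm (x t) < \<rho>"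
    using inside t .
qed

text \<open>Any \<open>c\<close> strictly between the spectrum and the imaginary axis serves as decay rate. Global
  existence comes from the truncated field: it satisfies the same energy inequality in the ball,
  so its solutions remain where both fields agree.\<close>

theorem exponentially_stable_if_eigenvalues_negative:
  fixes A :: "real^'m^'m"
  assumes "(g has_derivative (*v) A) (at 0)" "g 0 = 0"
    and "K-lipschitz_on (cball 0 r) g" "r > 0"
    and "\<forall>\<mu>\<in>eigenvalues A. Re \<mu> < 0"
  shows "exponentially_stable g 0"
proof -
  define c where "c = Max (Re ` eigenvalues A) / 2"
  have "Max (Re ` eigenvalues A) < 0"
    using assms(5) eigenvalues_nonempty[of A] by (subst Max_less_iff) (auto simp: finite_eigenvalues)
  moreover have "Re \<mu> \<le> Max (Re ` eigenvalues A)" if "\<mu> \<in> eigenvalues A" for \<mu>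
    using that by (simp add: finite_eigenvalues)
  ultimately have c: "c < 0" "\<forall>\<mu>\<in>eigenvalues A. Re \<mu> < c"
    by (auto simp: c_def) (smt (verit) field_sum_of_halves)
  then have "c \<notin> Re ` eigenvalues A"
    by force
  then obtain Q \<eta> where Q: "bilinear Q" "\<And>x y. Q x y = Q y x" "\<eta> > 0"
    "\<And>x. \<eta> * (norm x)\<^sup>2 \<le> Q x (A *v x - c *\<^sub>R x)" "\<And>x. Q x x \<le> - (norm x)\<^sup>2"
    using spectral_gap_energy_form[of c A] c(2) by blast
  obtain \<rho> where \<rho>: "\<rho> > 0" "\<rho> \<le> r" "\<And>y. norm y \<le> \<rho> \<Longrightarrow> c * Q y y \<le> Q y (g y)"
    using energy_inequality_near_equilibrium[OF Q(1,3,4) assms(1,2,4)] by auto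
  obtain B where B: "B > 0" "\<And>x y. norm (Q x y) \<le> B * norm x * norm y"
    using bilinear_bounded_pos[OF Q(1)] by metis
  define C where "C = sqrt B"
  have C: "C > 0" "\<bar>Q y y\<bar> \<le> (C * norm y)\<^sup>2" for y
    using B(1) B(2)[of y y] by (simp_all add: C_def power_mult_distrib)
      (simp add: power2_eq_square)
  define h where "h = g \<circ> closest_point (cball 0 \<rho>)"
  have h: "h y = g y" if "norm y \<le> \<rho>" for y
    using that by (simp add: h_def closest_point_self)
  have h_ineq: "c * Q y y \<le> Q y (h y)" if "norm y \<le> \<rho>" for y
    using \<rho>(3)[OF that] h[OF that] by simp
  have "\<exists>x. solves_on g x {0..} \<and> x 0 = x0" if small: "C * norm x0 < \<rho>" for x0
  proof -
    obtain x where x: "solves_on h x {0..}" "x 0 = x0"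
      using truncated_field_solution_exists[OF lipschitz_on_subset[OF assms(3)] \<rho>(1), of x0]
        subset_cball[OF \<rho>(2)] unfolding h_def by blast
    have "norm (x t) < \<rho>" if "t \<ge> 0" for t
      using that small x(2)
      by (intro energy_decay_along_solution(2)[OF Q(1,2,5) C(2) h_ineq c(1) C(1), of _ x "t + 1"]
          solves_on_subset[OF x(1)]) auto
    then have "solves_on g x {0..}"
      using x(1) h by (auto simp: solves_on_def less_imp_le)
    then show ?thesis
      using x(2) by blast
  qed
  moreover have "norm (x t) \<le> C * exp (- (- c) * t) * norm x0"
    if "C * norm x0 < \<rho>" "solves_on g x {0..<T}" "x 0 = x0" "t \<in> {0..<T}" for x x0 T t
    using energy_decay_along_solution(1)[OF Q(1,2,5) C(2) \<rho>(3) c(1) C(1), of \<rho> x T t] that by simp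
  moreover have "C * norm x0 < \<rho> \<longleftrightarrow> norm (x0 - 0) < \<rho> / C" for x0 :: "real^'m"
    using C(1) by (simp add: field_simps)
  ultimately show ?thesis
    unfolding exponentially_stable_def using C(1) c(1) \<rho>(1)
    by (intro exI[of _ "\<rho> / C"] exI[of _ C] exI[of _ "- c"] conjI) auto
qed

lemma exponentially_stable_imp_lyapunov_stable:
  assumes "exponentially_stable g p"
  shows "lyapunov_stable g p"
  unfolding lyapunov_stable_def
proof (intro allI impI)
  fix \<epsilon> :: real assume "\<epsilon> > 0"
  obtain \<delta> C r where *: "\<delta> > 0" "C > 0" "r > 0" "\<And>x0. norm (x0 - p) < \<delta> \<Longrightarrow>
      (\<exists>x. solves_on g x {0..} \<and> x 0 = x0) \<and>
      (\<forall>x T. solves_on g x {0..<T} \<and> x 0 = x0 \<longrightarrow>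
        (\<forall>t\<in>{0..<T}. norm (x t - p) \<le> C * exp (- r * t) * norm (x0 - p)))"
    using assms unfolding exponentially_stable_def by metis
  have "norm (x t - p) < \<epsilon>"
    if x0: "norm (x 0 - p) < min \<delta> (\<epsilon> / C)" and sol: "solves_on g x {0..<T}" "t \<in> {0..<T}" for x T t
  proof -
    have "norm (x t - p) \<le> C * exp (- r * t) * norm (x 0 - p)"
      using * that by auto
    also have "\<dots> \<le> C * 1 * norm (x 0 - p)"
      using * that by (intro mult_right_mono mult_left_mono) auto
    also have "\<dots> < \<epsilon>"
      using x0 *(2) by (simp add: field_simps)
    finally show ?thesis .
  qed
  then show "\<exists>\<delta>>0. \<forall>x0. norm (x0 - p) < \<delta> \<longrightarrow>
      (\<exists>x. solves_on g x {0..} \<and> x 0 = x0) \<and>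
      (\<forall>x T. solves_on g x {0..<T} \<and> x 0 = x0 \<longrightarrow> (\<forall>t\<in>{0..<T}. norm (x t - p) < \<epsilon>))"
    using * \<open>\<epsilon> > 0\<close> by (intro exI[of _ "min \<delta> (\<epsilon> / C)"]) auto
qed

section \<open>Spectrum and linearization of the network\<close>

text \<open>By Gershgorin's theorem \<open>z\<close> lies in a closed disc around some \<open>L\<^sub>i\<^sub>i\<close> with radius at
  most \<open>L\<^sub>i\<^sub>i\<close>. Such a disc lies in the closed right half plane and meets the
  imaginary axis at most in \<open>0\<close>. The index
  \<open>i\<close> is that of a largest component of the eigenvector.\<close>

lemma Re_eigenvalue_diagonally_dominant:
  assumes dominant: "\<And>i. (\<Sum>j\<in>UNIV - {i}. \<bar>L $ i $ j\<bar>) \<le> L $ i $ i"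
    and "z \<in> eigenvalues L"
  shows "Re z > 0 \<or> z = 0"
proof -
  obtain v where v: "v \<noteq> 0" "map_matrix complex_of_real L *v v = z *s v"
    using assms(2) by (auto simp: eigenvalues_def)
  have "Max (range (\<lambda>j. norm (v $ j))) \<in> range (\<lambda>j. norm (v $ j))"
    by (intro Max_in) auto
  then obtain i where "Max (range (\<lambda>j. norm (v $ j))) = norm (v $ i)"
    by (rule imageE)
  then have i: "norm (v $ j) \<le> norm (v $ i)" for j
    by (metis Max_ge finite finite_imageI rangeI)
  obtain j where "v $ j \<noteq> 0"
    using v(1) by (auto simp: vec_eq_iff)
  then have "norm (v $ i) > 0"
    using i[of j] by (meson less_le_trans zero_less_norm_iff)
  have "z * v $ i = (\<Sum>j\<in>UNIV. L $ i $ j * v $ j)"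
    using arg_cong[OF v(2), of "\<lambda>w. w $ i"] by (simp add: matrix_vector_mult_def)
  then have "(z - L $ i $ i) * v $ i = (\<Sum>j\<in>UNIV - {i}. L $ i $ j * v $ j)"
    by (simp add: sum.remove[of UNIV i] algebra_simps)
  then have "norm (z - L $ i $ i) * norm (v $ i) = norm (\<Sum>j\<in>UNIV - {i}. L $ i $ j * v $ j)"
    by (metis norm_mult)
  also have "\<dots> \<le> (\<Sum>j\<in>UNIV - {i}. \<bar>L $ i $ j\<bar> * norm (v $ i))"
    by (intro sum_norm_le) (auto simp: norm_mult intro!: mult_left_mono i)
  also have "\<dots> \<le> L $ i $ i * norm (v $ i)"
    using dominant by (simp flip: sum_distrib_right add: mult_right_mono)
  finally have "norm (z - L $ i $ i) \<le> L $ i $ i"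
    using \<open>norm (v $ i) > 0\<close> by simp
  then have "(norm (z - L $ i $ i))\<^sup>2 \<le> (L $ i $ i)\<^sup>2" and "0 \<le> L $ i $ i"
    using norm_ge_zero order_trans by (blast intro: power_mono)+
  then have "(Re z)\<^sup>2 + (Im z)\<^sup>2 \<le> 2 * L $ i $ i * Re z"
    by (simp add: cmod_power2 power2_diff algebra_simps)
  moreover have "2 * L $ i $ i * Re z \<le> 0" if "Re z \<le> 0"
    using that \<open>0 \<le> L $ i $ i\<close> by (simp add: mult_nonneg_nonpos)
  ultimately have "(Re z)\<^sup>2 + (Im z)\<^sup>2 \<le> 0" if "Re z \<le> 0"
    using that by linarith
  then show ?thesis
    by (metis complex_eq_iff leI sum_power2_le_zero_iff zero_complex.simps)
qed

text \<open>Equality holds, since both matrices have the in-degrees on the diagonal; without loops the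
  off-diagonal entries of a row account for the whole in-degree.\<close>

lemma laplacian_diagonally_dominant:
  fixes G :: "('n::finite, 'e) pre_digraph"
  assumes "loopfree_digraph G" "L = laplacian G \<or> L = signless_laplacian G"
  shows "(\<Sum>j\<in>UNIV - {i}. \<bar>L $ i $ j\<bar>) \<le> L $ i $ i"
proof -
  let ?A = "adjacency_matrix G"
  have "(i, i) \<notin> arcs_ends G"
    using loopfree_digraph.no_loops[OF assms(1)] by (auto simp: arcs_ends_def arc_to_ends_def)
  then have diag: "?A $ i $ i = 0"
    by (simp add: adjacency_matrix_def)
  have "L $ i $ i = (\<Sum>j\<in>UNIV. ?A $ i $ j)"
    using assms(2) diag
    by (auto simp: laplacian_def signless_laplacian_def in_degree_matrix_def diag_matrix_def
        matrix_vector_mult_def)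
  moreover have "\<bar>L $ i $ j\<bar> = ?A $ i $ j" if "j \<noteq> i" for j
    using assms(2) that
    by (auto simp: laplacian_def signless_laplacian_def in_degree_matrix_def diag_matrix_def
        adjacency_matrix_def)
  ultimately show ?thesis
    by (simp add: sum.remove[of UNIV i] diag)
qed

lemma sum_prod_UNIV:
  fixes h :: "'a::finite \<Rightarrow> 'b::finite \<Rightarrow> 'c::comm_monoid_add"
  shows "(\<Sum>q\<in>UNIV. h (fst q) (snd q)) = (\<Sum>a\<in>UNIV. \<Sum>b\<in>UNIV. h a b)"
  by (simp add: sum.cartesian_product case_prod_unfold)

lemma kronecker_mat_left_mult:
  "(map_matrix complex_of_real (kronecker (mat 1) J) *v v) $ (i, k) = (\<Sum>l\<in>UNIV. J $ k $ l * v $ (i, l))"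
proof -
  have "(map_matrix complex_of_real (kronecker (mat 1) J) *v v) $ (i, k)
      = (\<Sum>q\<in>UNIV. if i = fst q then J $ k $ snd q * v $ (fst q, snd q) else 0)"
    by (auto simp: matrix_vector_mult_def kronecker_def mat_def intro!: sum.cong)
  also have "\<dots> = (\<Sum>j\<in>UNIV. \<Sum>l\<in>UNIV. if i = j then J $ k $ l * v $ (j, l) else 0)"
    by (subst sum_prod_UNIV) (rule refl)
  also have "\<dots> = (\<Sum>j\<in>UNIV. if i = j then \<Sum>l\<in>UNIV. J $ k $ l * v $ (j, l) else 0)"
    by (rule sum.cong) simp_all
  finally show ?thesis
    by simp
qed

lemma kronecker_mat_right_mult:
  "(map_matrix complex_of_real (kronecker L (mat 1)) *v v) $ (i, k) = (\<Sum>j\<in>UNIV. L $ i $ j * v $ (j, k))"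
proof -
  have "(map_matrix complex_of_real (kronecker L (mat 1)) *v v) $ (i, k)
      = (\<Sum>q\<in>UNIV. if k = snd q then L $ i $ fst q * v $ (fst q, snd q) else 0)"
    by (auto simp: matrix_vector_mult_def kronecker_def mat_def intro!: sum.cong)
  also have "\<dots> = (\<Sum>j\<in>UNIV. \<Sum>l\<in>UNIV. if k = l then L $ i $ j * v $ (j, l) else 0)"
    by (subst sum_prod_UNIV) (rule refl)
  finally show ?thesis
    by simp
qed

definition network_jacobian ::
    "real^'d^'d \<Rightarrow> real^'n^'n \<Rightarrow> real \<Rightarrow> real^('n::finite \<times> 'd::finite)^('n::finite \<times> 'd::finite)" where
  "network_jacobian J L \<alpha> = kronecker (mat 1) J + \<alpha> *\<^sub>R kronecker L (mat 1)"

lemma network_jacobian_complex_mult: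
  "map_matrix complex_of_real (network_jacobian J L \<alpha>) *v v
    = map_matrix complex_of_real (kronecker (mat 1) J) *v v
      + complex_of_real \<alpha> *s (map_matrix complex_of_real (kronecker L (mat 1)) *v v)"
  by (simp add: vec_eq_iff network_jacobian_def matrix_vector_mult_def sum.distrib sum_distrib_left
      algebra_simps)

text \<open>The two summands of the network Jacobian commute, so an eigenvector of the sum may be replaced
  by a common eigenvector. A nonzero node slice of it is an eigenvector of \<open>J\<close>, a nonzero
  coordinate slice one of \<open>L\<close>. Conversely, products of eigenvectors of \<open>L\<close> and
  \<open>J\<close> are eigenvectors of the sum.\<close>

lemma eigenvalues_network_jacobian:
  fixes J :: "real^'d^'d" and L :: "real^'n^'n"
  shows "eigenvalues (network_jacobian J L \<alpha>)
    = {\<nu> + complex_of_real \<alpha> * z | \<nu> z. \<nu> \<in> eigenvalues J \<and> z \<in> eigenvalues L}"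
proof (intro Set.equalityI subsetI)
  let ?B = "map_matrix complex_of_real (kronecker (mat 1 :: real^'n^'n) J)"
  let ?C = "map_matrix complex_of_real (kronecker L (mat 1 :: real^'d^'d))"
  let ?M = "map_matrix complex_of_real (network_jacobian J L \<alpha>)"
  fix \<mu> assume "\<mu> \<in> eigenvalues (network_jacobian J L \<alpha>)"
  then obtain w where w: "w \<noteq> 0" "?M *v w = \<mu> *s w"
    by (auto simp: eigenvalues_def)
  have "?C *v (?B *v v) = ?B *v (?C *v v)" for v
  proof -
    have "(?C *v (?B *v v)) $ (i, k) = (?B *v (?C *v v)) $ (i, k)" for i k
      unfolding kronecker_mat_left_mult kronecker_mat_right_mult sum_distrib_left
      by (subst sum.swap) (simp add: mult.left_commute)
    then show ?thesis
      by (auto simp: vec_eq_iff)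
  qed
  then have "?C *v (?M *v v) = ?M *v (?C *v v)" for v
    by (simp add: network_jacobian_complex_mult matrix_vector_right_distrib vector_scalar_commute)
  then obtain v z where v: "v \<noteq> 0" "?M *v v = \<mu> *s v" "?C *v v = z *s v"
    using commuting_matrices_common_eigenvector[of ?C ?M w \<mu>] w by metis
  obtain i k where ik: "v $ (i, k) \<noteq> 0"
    using v(1) by (auto simp: vec_eq_iff)
  have "?B *v v = (\<mu> - \<alpha> * z) *s v"
    using v(2) unfolding network_jacobian_complex_mult v(3)
    by (simp add: vector_smult_assoc vector_sub_rdistrib algebra_simps)
  then have "(\<Sum>l\<in>UNIV. J $ m $ l * v $ (i, l)) = (\<mu> - \<alpha> * z) * v $ (i, m)" for m
    using kronecker_mat_left_mult[of J v i m] by (simp add: left_diff_distrib)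
  then have "map_matrix complex_of_real J *v (\<chi> l. v $ (i, l)) = (\<mu> - \<alpha> * z) *s (\<chi> l. v $ (i, l))"
    by (simp add: vec_eq_iff matrix_vector_mult_def left_diff_distrib)
  moreover have "(\<chi> l. v $ (i, l)) \<noteq> 0"
    using ik by (auto simp: vec_eq_iff)
  ultimately have "\<mu> - \<alpha> * z \<in> eigenvalues J"
    unfolding eigenvalues_def by blast
  have "(\<Sum>j\<in>UNIV. L $ m $ j * v $ (j, k)) = z * v $ (m, k)" for m
    using kronecker_mat_right_mult[of L v m k] v(3) by simp
  then have "map_matrix complex_of_real L *v (\<chi> j. v $ (j, k)) = z *s (\<chi> j. v $ (j, k))"
    by (simp add: vec_eq_iff matrix_vector_mult_def)
  moreover have "(\<chi> j. v $ (j, k)) \<noteq> 0"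
    using ik by (auto simp: vec_eq_iff)
  ultimately have "z \<in> eigenvalues L"
    unfolding eigenvalues_def by blast
  then show "\<mu> \<in> {\<nu> + complex_of_real \<alpha> * z | \<nu> z. \<nu> \<in> eigenvalues J \<and> z \<in> eigenvalues L}"
    using \<open>\<mu> - \<alpha> * z \<in> eigenvalues J\<close> by force
next
  fix \<mu> assume "\<mu> \<in> {\<nu> + complex_of_real \<alpha> * z | \<nu> z. \<nu> \<in> eigenvalues J \<and> z \<in> eigenvalues L}"
  then obtain \<nu> z :: complex and y u where \<mu>: "\<mu> = \<nu> + \<alpha> * z"
    and y: "y \<noteq> 0" "map_matrix complex_of_real J *v y = \<nu> *s y"
    and u: "u \<noteq> 0" "map_matrix complex_of_real L *v u = z *s u"
    by (auto simp: eigenvalues_def)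
  define v :: "complex^('n \<times> 'd)" where "v = (\<chi> p. u $ fst p * y $ snd p)"
  have "(\<Sum>l\<in>UNIV. J $ k $ l * y $ l) = \<nu> * y $ k" for k
    using arg_cong[OF y(2), of "\<lambda>w. w $ k"] by (simp add: matrix_vector_mult_def)
  then have "(\<Sum>l\<in>UNIV. J $ k $ l * v $ (i, l)) = \<nu> * v $ (i, k)" for i k
    by (simp add: v_def mult.left_commute flip: sum_distrib_left)
  moreover have "(\<Sum>j\<in>UNIV. L $ i $ j * u $ j) = z * u $ i" for i
    using arg_cong[OF u(2), of "\<lambda>w. w $ i"] by (simp add: matrix_vector_mult_def)
  then have "(\<Sum>j\<in>UNIV. L $ i $ j * v $ (j, k)) = z * v $ (i, k)" for i k
    by (simp add: v_def flip: mult.assoc sum_distrib_right)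
  ultimately have "map_matrix complex_of_real (network_jacobian J L \<alpha>) *v v = \<mu> *s v"
    by (auto simp: vec_eq_iff network_jacobian_complex_mult kronecker_mat_left_mult
        kronecker_mat_right_mult \<mu> algebra_simps)
  moreover have "v \<noteq> 0"
    using u(1) y(1) by (auto simp: vec_eq_iff v_def)
  ultimately show "\<mu> \<in> eigenvalues (network_jacobian J L \<alpha>)"
    unfolding eigenvalues_def by blast
qed

lemma linear_node_state: "linear (\<lambda>x. node_state x i)"
  by (simp add: linear_iff node_state_def vec_eq_iff)

lemma node_state_0 [simp]: "node_state 0 i = 0"
  by (simp add: node_state_def vec_eq_iff)

lemma norm_node_state_le: "norm (node_state x i) \<le> norm x"
proof -
  have "(norm (node_state x i))\<^sup>2 = (\<Sum>k\<in>UNIV. (x $ (i, k))\<^sup>2)"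
    unfolding power2_norm_eq_inner inner_vec_def by (simp add: node_state_def power2_eq_square)
  also have "\<dots> = (\<Sum>p\<in>Pair i ` UNIV. (x $ p)\<^sup>2)"
    by (simp add: sum.reindex inj_on_def)
  also have "\<dots> \<le> (\<Sum>p\<in>UNIV. (x $ p)\<^sup>2)"
    by (intro sum_mono2) auto
  also have "\<dots> = (norm x)\<^sup>2"
    unfolding power2_norm_eq_inner inner_vec_def by (simp add: power2_eq_square)
  finally show ?thesis
    by (rule power2_le_imp_le) simp
qed

lemma kronecker_mat_left_real_mult:
  "(kronecker (mat 1) J *v x) $ p = (J *v node_state x (fst p)) $ snd p"
proof -
  have "(kronecker (mat 1) J *v x) $ p
      = (\<Sum>q\<in>UNIV. if fst p = fst q then J $ snd p $ snd q * x $ (fst q, snd q) else 0)"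
    by (auto simp: matrix_vector_mult_def kronecker_def mat_def intro!: sum.cong)
  also have "\<dots> = (\<Sum>j\<in>UNIV. \<Sum>l\<in>UNIV. if fst p = j then J $ snd p $ l * x $ (j, l) else 0)"
    by (subst sum_prod_UNIV) (rule refl)
  also have "\<dots> = (\<Sum>j\<in>UNIV. if fst p = j then \<Sum>l\<in>UNIV. J $ snd p $ l * x $ (j, l) else 0)"
    by (rule sum.cong) simp_all
  finally show ?thesis
    by (simp add: matrix_vector_mult_def node_state_def)
qed

lemma network_field_has_derivative:
  fixes f :: "real^'d \<Rightarrow> real^'d" and L :: "real^'n^'n"
  assumes "(f has_derivative (*v) J) (at 0)"
  shows "(network_field f L \<alpha> has_derivative (*v) (network_jacobian J L \<alpha>)) (at 0)"
proof -
  have node: "((\<lambda>x. f (node_state x i) $ k) has_derivative (\<lambda>h. (J *v node_state h i) $ k)) (at 0)"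
    for i :: 'n and k
  proof -
    have bounded: "bounded_linear (\<lambda>x :: real^('n \<times> 'd). node_state x i)"
      using linear_node_state by (simp add: linear_conv_bounded_linear)
    have "(f has_derivative (*v) J) (at (node_state (0 :: real^('n \<times> 'd)) i))"
      using assms by simp
    from has_derivative_compose[OF bounded_linear_imp_has_derivative[OF bounded] this]
    show ?thesis
      by (rule bounded_linear.has_derivative[OF bounded_linear_vec_nth])
  qed
  have "(stack_field f has_derivative (*v) (kronecker (mat 1 :: real^'n^'n) J)) (at 0)"
  proof (rule has_derivative_componentwise_within[THEN iffD2], rule ballI)
    fix b :: "real^('n \<times> 'd)" assume "b \<in> Basis"
    then obtain p where "b = axis p 1"
      by (auto simp: Basis_vec_def)
    then show "((\<lambda>x. stack_field f x \<bullet> b) has_derivative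
        (\<lambda>h. (kronecker (mat 1) J *v h) \<bullet> b)) (at 0)"
      using node[of "fst p" "snd p"]
      by (simp add: inner_axis stack_field_def kronecker_mat_left_real_mult)
  qed
  moreover have "((\<lambda>x. \<alpha> *\<^sub>R (kronecker L (mat 1 :: real^'d^'d) *v x))
      has_derivative (\<lambda>h. \<alpha> *\<^sub>R (kronecker L (mat 1) *v h))) (at 0)"
    by (intro bounded_linear_imp_has_derivative bounded_linear_compose[OF bounded_linear_scaleR_right]
        matrix_vector_mul_bounded_linear)
  ultimately have "(network_field f L \<alpha> has_derivative
      (\<lambda>h. kronecker (mat 1) J *v h + \<alpha> *\<^sub>R (kronecker L (mat 1) *v h))) (at 0)"
    unfolding network_field_def by (rule has_derivative_add)
  moreover have "(\<lambda>h. kronecker (mat 1) J *v h + \<alpha> *\<^sub>R (kronecker L (mat 1) *v h))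
      = (*v) (network_jacobian J L \<alpha>)"
    by (simp add: fun_eq_iff network_jacobian_def matrix_vector_mult_add_rdistrib
        scaleR_matrix_vector_mult)
  ultimately show ?thesis
    by simp
qed

lemma C1_lipschitz_on_cball:
  fixes f :: "real^'d \<Rightarrow> real^'d"
  assumes "C1 f"
  obtains K where "K-lipschitz_on (cball a r) f"
proof -
  have "compact ((\<lambda>x. jacobian f (at x)) ` cball a r)"
    using assms unfolding C1_def
    by (intro compact_continuous_image) (auto intro: continuous_on_subset)
  then obtain B where B: "\<And>x. x \<in> cball a r \<Longrightarrow> norm (jacobian f (at x)) \<le> B"
    using compact_imp_bounded by (fastforce simp: bounded_iff)
  show ?thesis
  proof
    show "(real CARD('d) * real CARD('d) * max B 0)-lipschitz_on (cball a r) f"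
    proof (rule bounded_derivative_imp_lipschitz)
      show "(f has_derivative (\<lambda>h. jacobian f (at x) *v h)) (at x within cball a r)" for x
        using assms unfolding C1_def jacobian_works by (blast intro: has_derivative_at_withinI)
      show "onorm ((*v) (jacobian f (at x))) \<le> real CARD('d) * real CARD('d) * max B 0"
        if "x \<in> cball a r" for x
      proof (rule onorm_le_matrix_component)
        show "\<bar>jacobian f (at x) $ i $ j\<bar> \<le> max B 0" for i j
          using component_le_norm_cart[of "jacobian f (at x) $ i" j]
            Finite_Cartesian_Product.norm_nth_le[of "jacobian f (at x)" i] B[OF that] by linarith
      qed
    qed auto
  qed
qed

lemma network_field_lipschitz:
  fixes f :: "real^'d \<Rightarrow> real^'d" and L :: "real^'n^'n"
  assumes "C1 f"
  obtains K where "K-lipschitz_on (cball 0 r) (network_field f L \<alpha>)"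
proof -
  obtain K where K: "K-lipschitz_on (cball 0 r) f"
    using C1_lipschitz_on_cball[OF assms] .
  have "(real CARD('n \<times> 'd) * K)-lipschitz_on (cball 0 r) (stack_field f :: real^('n \<times> 'd) \<Rightarrow> _)"
  proof (rule lipschitz_onI)
    fix x y :: "real^('n \<times> 'd)" assume xy: "x \<in> cball 0 r" "y \<in> cball 0 r"
    have "\<bar>(stack_field f x - stack_field f y) $ p\<bar> \<le> K * norm (x - y)" for p
    proof -
      have "\<bar>(stack_field f x - stack_field f y) $ p\<bar>
          \<le> norm (f (node_state x (fst p)) - f (node_state y (fst p)))"
        using component_le_norm_cart[of "f (node_state x (fst p)) - f (node_state y (fst p))" "snd p"]
        by (simp add: stack_field_def)
      also have "\<dots> \<le> K * norm (node_state x (fst p) - node_state y (fst p))"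
        using xy lipschitz_onD[OF K, of "node_state x (fst p)" "node_state y (fst p)"]
          norm_node_state_le[of x "fst p"] norm_node_state_le[of y "fst p"]
        by (simp add: dist_norm)
      also have "\<dots> \<le> K * norm (x - y)"
        using norm_node_state_le[of "x - y" "fst p"] lipschitz_on_nonneg[OF K]
        by (intro mult_left_mono) (simp_all add: linear_diff[OF linear_node_state])
      finally show ?thesis .
    qed
    then have "(\<Sum>p\<in>UNIV. \<bar>(stack_field f x - stack_field f y) $ p\<bar>)
        \<le> of_nat (card (UNIV :: ('n \<times> 'd) set)) * (K * norm (x - y))"
      by (intro sum_bounded_above)
    then show "dist (stack_field f x) (stack_field f y) \<le> real CARD('n \<times> 'd) * K * dist x y"
      using norm_le_l1_cart[of "stack_field f x - stack_field f y"]
      by (simp add: dist_norm mult.assoc)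
  qed (use lipschitz_on_nonneg[OF K] in simp)
  moreover have "bounded_linear (\<lambda>x. \<alpha> *\<^sub>R (kronecker L (mat 1 :: real^'d^'d) *v x))"
    by (intro bounded_linear_compose[OF bounded_linear_scaleR_right] matrix_vector_mul_bounded_linear)
  then obtain B where "B-lipschitz_on (cball 0 r) (\<lambda>x. \<alpha> *\<^sub>R (kronecker L (mat 1 :: real^'d^'d) *v x))"
    by (rule bounded_linear.lipschitz_boundE)
  ultimately have "(real CARD('n \<times> 'd) * K + B)-lipschitz_on (cball 0 r) (network_field f L \<alpha>)"
    unfolding network_field_def by (rule lipschitz_on_add)
  then show ?thesis
    by (rule that)
qed

theorem proposition6:
  fixes G :: "('n::finite, 'e) pre_digraph"
    and f :: "real^'d \<Rightarrow> real^'d"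
    and L :: "real^'n^'n"
  assumes "digraph G" and "verts G = UNIV" and "Digraph_Component.connected G"
    and "CARD('n) \<ge> 2"
    and "C1 f" and "f 0 = 0"
    and "Max (Re ` eigenvalues (jacobian f (at 0))) \<noteq> 0"
    and "L = laplacian G \<or> L = signless_laplacian G"
    and "0 \<notin> eigenvalues L"
    and "\<not> lyapunov_stable f 0"
  shows "\<exists>\<alpha>\<^sub>c<0.
    (\<forall>\<alpha><\<alpha>\<^sub>c. exponentially_stable (network_field f L \<alpha>) 0) \<and>
    (\<forall>\<alpha>>\<alpha>\<^sub>c. \<not> lyapunov_stable (network_field f L \<alpha>) 0)"
proof -
  define J where "J = jacobian f (at 0)"
  have J: "(f has_derivative (*v) J) (at 0)"
    using \<open>C1 f\<close> unfolding C1_def J_def jacobian_works by blast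
  define \<nu>\<^sub>m where "\<nu>\<^sub>m = Max (Re ` eigenvalues J)"
  define z\<^sub>m where "z\<^sub>m = Min (Re ` eigenvalues L)"
  have "\<nu>\<^sub>m \<in> Re ` eigenvalues J" "z\<^sub>m \<in> Re ` eigenvalues L"
    unfolding \<nu>\<^sub>m_def z\<^sub>m_def using eigenvalues_nonempty[of J] eigenvalues_nonempty[of L]
    by (intro Max_in Min_in; simp add: finite_eigenvalues)+
  then obtain \<nu> z where \<nu>: "\<nu> \<in> eigenvalues J" "Re \<nu> = \<nu>\<^sub>m" and z: "z \<in> eigenvalues L" "Re z = z\<^sub>m"
    by auto
  have \<nu>\<^sub>m_max: "Re \<nu>' \<le> \<nu>\<^sub>m" if "\<nu>' \<in> eigenvalues J" for \<nu>'
    using that by (simp add: \<nu>\<^sub>m_def finite_eigenvalues)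
  have z\<^sub>m_min: "z\<^sub>m \<le> Re z'" if "z' \<in> eigenvalues L" for z'
    using that by (simp add: z\<^sub>m_def finite_eigenvalues)
  have "loopfree_digraph G"
    using \<open>digraph G\<close> by (simp add: digraph_def)
  then have "z\<^sub>m > 0"
    using Re_eigenvalue_diagonally_dominant[OF laplacian_diagonally_dominant[OF _ assms(8)] z(1)]
      assms(9) z by auto
  have "\<not> \<nu>\<^sub>m < 0"
  proof
    assume "\<nu>\<^sub>m < 0"
    obtain K where "K-lipschitz_on (cball 0 1) f"
      using C1_lipschitz_on_cball[OF \<open>C1 f\<close>] .
    then have "exponentially_stable f 0"
      using exponentially_stable_if_eigenvalues_negative[OF J \<open>f 0 = 0\<close>, of K 1] \<nu>\<^sub>m_max \<open>\<nu>\<^sub>m < 0\<close>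
      by force
    then show False
      using exponentially_stable_imp_lyapunov_stable assms(10) by blast
  qed
  then have "\<nu>\<^sub>m > 0"
    using assms(7) by (simp add: \<nu>\<^sub>m_def J_def)
  have origin: "network_field f L \<alpha> 0 = 0" for \<alpha>
    using \<open>f 0 = 0\<close> by (simp add: network_field_def stack_field_def vec_eq_iff)
  have stable: "exponentially_stable (network_field f L \<alpha>) 0" if \<alpha>: "\<alpha> < - \<nu>\<^sub>m / z\<^sub>m" for \<alpha>
  proof -
    have neg: "\<nu>\<^sub>m + \<alpha> * z\<^sub>m < 0"
      using \<alpha> \<open>z\<^sub>m > 0\<close> by (simp add: field_simps)
    have "- \<nu>\<^sub>m / z\<^sub>m < 0"
      using \<open>\<nu>\<^sub>m > 0\<close> \<open>z\<^sub>m > 0\<close> by simp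
    with \<alpha> have "\<alpha> \<le> 0"
      by linarith
    have "Re (\<nu>' + \<alpha> * z') < 0" if "\<nu>' \<in> eigenvalues J" "z' \<in> eigenvalues L" for \<nu>' z' :: complex
      using \<nu>\<^sub>m_max[OF that(1)] mult_left_mono_neg[OF z\<^sub>m_min[OF that(2)] \<open>\<alpha> \<le> 0\<close>] neg by simp
    then have "\<forall>\<mu>\<in>eigenvalues (network_jacobian J L \<alpha>). Re \<mu> < 0"
      unfolding eigenvalues_network_jacobian by blast
    moreover obtain K where "K-lipschitz_on (cball 0 1) (network_field f L \<alpha>)"
      using network_field_lipschitz[OF \<open>C1 f\<close>] .
    ultimately show ?thesis
      using exponentially_stable_if_eigenvalues_negative network_field_has_derivative[OF J] origin
      by (metis zero_less_one)
  qed
  have unstable: "\<not> lyapunov_stable (network_field f L \<alpha>) 0" if \<alpha>: "\<alpha> > - \<nu>\<^sub>m / z\<^sub>m" for \<alpha>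
  proof (rule unstable_if_eigenvalue_positive[OF network_field_has_derivative[OF J] origin])
    show "\<nu> + \<alpha> * z \<in> eigenvalues (network_jacobian J L \<alpha>)"
      unfolding eigenvalues_network_jacobian using \<nu>(1) z(1) by blast
    show "Re (\<nu> + \<alpha> * z) > 0"
      using \<alpha> \<open>z\<^sub>m > 0\<close> \<nu>(2) z(2) by (simp add: field_simps)
  qed
  show ?thesis
    using stable unstable \<open>\<nu>\<^sub>m > 0\<close> \<open>z\<^sub>m > 0\<close> by (intro exI[of _ "- \<nu>\<^sub>m / z\<^sub>m"]) simp
qed

end
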